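(* Let $\mathcal M=\mathcal M(\Sigma,I)$ be an irreducible trace monoid with $\Sigma\neq\emptyset$, let $X=\mathcal C$ be the set of cliques of $\mathcal M$, and let $(\mathcal M,X)$ be the irreducible concurrent system whose action is the unique extension of the map $X\times\Sigma\to X\cup\{\bot\}$, $(\gamma,a)\mapsto\gamma\cdot a$, defined by $$\gamma\cdot a=\begin{cases}\gamma\cup\{a\},&\text{if }a\notin\gamma\text{ and }\gamma\cup\{a\}\in\mathcal C,\\ \gamma\setminus\{a\},&\text{if }a\in\gamma,\\ \bot,&\text{otherwise.}\end{cases}$$ Let $f_\alpha(x)=\rho^{|x|}\Delta(\alpha,\alpha\cdot x)$ be the probabilistic valuation associated with the uniform measure of $(\mathcal M,X)$, where $\rho>0$ and $\Delta$ is a positive cocycle on $X$. Let $r$ be the root of smallest modulus of the Möbius polynomial $\mu(z)=\sum_{\gamma\in\mathcal C}(-1)^{|\gamma|}z^{|\gamma|}$ of $\mathcal M$. Then $\rho=\sqrt r$ and $\Delta(\alpha,\beta)=r^{\frac12(|\beta|-|\alpha|)}$ for all $\alpha,\beta\in X$.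
   Context: Trace monoids. Let $\Sigma$ be a finite set and $I\subseteq\Sigma\times\Sigma$ irreflexive and symmetric. The trace monoid $\mathcal M=\mathcal M(\Sigma,I)$ is presented by $\langle\Sigma\mid ab=ba\text{ for }(a,b)\in I\rangle$. Its elements are traces, $\varepsilon$ is the unit, $|x|$ is the length of $x$, and $x\leqslant y$ means $y=xz$ for some $z\in\mathcal M$. $\mathcal M$ is irreducible if the graph $(\Sigma,(\Sigma\times\Sigma)\setminus I)$ is connected. A clique is a trace $a_1\cdots a_k$ of letters with $(a_i,a_j)\in I$ for $i\neq j$ (empty trace included); $\mathcal C$ is the set of cliques, identified with subsets of $\Sigma$. The Möbius polynomial has a unique complex root of smallest modulus, and it is a positive real in $(0,1]$. For cliques write $c\to d$ if for every letter $b\in d$ there is a letter $a\in c$ with $(a,b)\notin I$. Infinite traces. An infinite trace is a sequence $\omega=(c_i)_{i\geqslant1}$ of non-empty cliques with $c_i\to c_{i+1}$ for all $i$; $C_i(\omega)=c_i$. The set $\partial\mathcal M$ of infinite traces carries its Borel $\sigma$-algebra. For $x\in\mathcal M$, $x\leqslant\omega$ means $x\leqslant C_1(\omega)\cdots C_n(\omega)$ for some $n$, and ${\uparrow}x=\{\omega\in\partial\mathcal M:x\leqslant\omega\}$. Concurrent systems. A concurrent system is a pair $(\mathcal M,X)$, $X$ a finite set of states, with a right monoid action of $\mathcal M$ on $X\sqcup\{\bot\}$, where $\bot\cdot x=\bot$ for all $x$. Put $\mathcal M_\alpha=\{x:\alpha\cdot x\neq\bot\}$, $\mathcal M_{\alpha,\beta}=\{x:\alpha\cdot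 x=\beta\}$, and $\partial\mathcal M_\alpha=\{\omega\in\partial\mathcal M: x\in\mathcal M_\alpha\text{ for all }x\in\mathcal M\text{ with }x\leqslant\omega\}$. It is irreducible if: (1) $\mathcal M_{\alpha,\beta}\neq\emptyset$ for all $\alpha,\beta\in X$, and $\alpha\cdot a\neq\bot$ for some $\alpha\in X$, $a\in\Sigma$; (2) $\mathcal M$ is irreducible; (3) for all $\alpha\in X$, $a\in\Sigma$ there is $u\in\mathcal M$ with $\alpha\cdot(ua)\neq\bot$. Valuations and the uniform measure. A valuation is a family $f=(f_\alpha)_{\alpha\in X}$ of functions $f_\alpha:\mathcal M\to\mathbb R_{\geqslant0}$ with $f_\alpha(x)>0\iff\alpha\cdot x\neq\bot$ and $f_\alpha(xy)=f_\alpha(x)f_{\alpha\cdot x}(y)$ (right-hand side $0$ if $\alpha\cdot x=\bot$). A Markov measure is a family $m=(m_\alpha)_{\alpha\in X}$ of probability measures on $\partial\mathcal M$ with $m_\alpha(\partial\mathcal M_\alpha)=1$, $x\in\mathcal M_\alpha\iff m_\alpha({\uparrow}x)>0$, and $m_\alpha({\uparrow}(xy))=m_\alpha({\uparrow}x)\,m_{\alpha\cdot x}({\uparrow}y)$. A valuation $f$ is probabilistic if $f_\alpha(x)=m_\alpha({\uparrow}x)$ for all $(\alpha,x)$, for some Markov measure $m$. A positive cocycle on $X$ is $\Delta:X\times X\to\mathbb R_{>0}$ with $\Delta(\alpha,\gamma)=\Delta(\alpha,\beta)\Delta(\beta,\gamma)$. For an irreducible concurrent system there is a unique pair $(\rho,\Delta)$,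 $\rho>0$ real and $\Delta$ a positive cocycle, such that the valuation given by $f_\alpha(x)=\rho^{|x|}\Delta(\alpha,\alpha\cdot x)$ for $x\in\mathcal M_\alpha$ (and $0$ otherwise) is probabilistic; the associated Markov measure is the uniform measure of $(\mathcal M,X)$. *)

theory Defs
  imports
    "HOL-Analysis.Analysis"
    "HOL-Probability.Probability"
    "HOL-Algebra.Group"
    "HOL-Computational_Algebra.Polynomial"
begin

section \<open>Trace monoids\<close>

inductive trace_cong :: "('a \<times> 'a) set \<Rightarrow> 'a list \<Rightarrow> 'a list \<Rightarrow> bool" for I where
  swap: "(a, b) \<in> I \<Longrightarrow> trace_cong I [a, b] [b, a]"
| refl: "trace_cong I u u"
| sym: "trace_cong I u v \<Longrightarrow> trace_cong I v u"
| trans: "trace_cong I u v \<Longrightarrow> trace_cong I v w \<Longrightarrow> trace_cong I u w"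
| app: "trace_cong I u u' \<Longrightarrow> trace_cong I v v' \<Longrightarrow> trace_cong I (u @ v) (u' @ v')"

text \<open>Traces are congruence classes of words. If \<open>I \<subseteq> S \<times> S\<close>, a class that contains a word
  over \<open>S\<close> consists of words over \<open>S\<close>.\<close>

definition trace_of :: "('a \<times> 'a) set \<Rightarrow> 'a list \<Rightarrow> 'a list set" where
  "trace_of I w = {v. trace_cong I w v}"

definition trace_monoid :: "'a set \<Rightarrow> ('a \<times> 'a) set \<Rightarrow> 'a list set monoid" where
  "trace_monoid S I =
     \<lparr>carrier = trace_of I ` lists S,
      mult = (\<lambda>x y. \<Union>u\<in>x. \<Union>v\<in>y. trace_of I (u @ v)),
      one = trace_of I []\<rparr>"

definition trace_length :: "'a list set \<Rightarrow> nat" where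
  "trace_length x = length (SOME w. w \<in> x)"

definition trace_le :: "'a set \<Rightarrow> ('a \<times> 'a) set \<Rightarrow> 'a list set \<Rightarrow> 'a list set \<Rightarrow> bool" where
  "trace_le S I x y \<longleftrightarrow>
     (\<exists>z \<in> carrier (trace_monoid S I). y = x \<otimes>\<^bsub>trace_monoid S I\<^esub> z)"

definition irreducible_trace_monoid :: "'a set \<Rightarrow> ('a \<times> 'a) set \<Rightarrow> bool" where
  "irreducible_trace_monoid S I \<longleftrightarrow> (\<forall>a\<in>S. \<forall>b\<in>S. (a, b) \<in> ((S \<times> S) - I)\<^sup>*)"

definition cliques :: "'a set \<Rightarrow> ('a \<times> 'a) set \<Rightarrow> 'a set set" where
  "cliques S I = {c. c \<subseteq> S \<and> (\<forall>a\<in>c. \<forall>b\<in>c. a \<noteq> b \<longrightarrow> (a, b) \<in> I)}"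

text \<open>The trace of a clique; it does not depend on the enumeration chosen, see
  \<open>clique_trace_set\<close> below.\<close>

definition clique_trace :: "('a \<times> 'a) set \<Rightarrow> 'a set \<Rightarrow> 'a list set" where
  "clique_trace I c = trace_of I (SOME w. distinct w \<and> set w = c)"

definition mobius_poly :: "'a set \<Rightarrow> ('a \<times> 'a) set \<Rightarrow> complex poly" where
  "mobius_poly S I = (\<Sum>c\<in>cliques S I. monom ((-1) ^ card c) (card c))"

text \<open>A minimal modulus over all complex roots is asked for, ties being allowed.\<close>

definition smallest_modulus_root :: "complex poly \<Rightarrow> complex \<Rightarrow> bool" where
  "smallest_modulus_root p z \<longleftrightarrow>
     poly p z = 0 \<and> (\<forall>w. poly p w = 0 \<longrightarrow> cmod z \<le> cmod w)"

definition clique_arrow :: "('a \<times> 'a) set \<Rightarrow> 'a set \<Rightarrow> 'a set \<Rightarrow> bool" where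
  "clique_arrow I c d \<longleftrightarrow> (\<forall>b\<in>d. \<exists>a\<in>c. (a, b) \<notin> I)"


section \<open>Infinite traces\<close>

text \<open>Sequences are indexed from 0: the value at \<open>i\<close> is the clique \<open>C\<^sub>i\<^sub>+\<^sub>1\<close>.\<close>

definition infinite_traces :: "'a set \<Rightarrow> ('a \<times> 'a) set \<Rightarrow> (nat \<Rightarrow> 'a set) set" where
  "infinite_traces S I =
     {\<omega>. \<forall>i. \<omega> i \<in> cliques S I \<and> \<omega> i \<noteq> {} \<and> clique_arrow I (\<omega> i) (\<omega> (Suc i))}"

definition infinite_trace_topology ::
    "'a set \<Rightarrow> ('a \<times> 'a) set \<Rightarrow> (nat \<Rightarrow> 'a set) topology" where
  "infinite_trace_topology S I =
     subtopology (product_topology (\<lambda>_. discrete_topology (cliques S I)) UNIV)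
       (infinite_traces S I)"

definition infinite_trace_borel ::
    "'a set \<Rightarrow> ('a \<times> 'a) set \<Rightarrow> (nat \<Rightarrow> 'a set) measure" where
  "infinite_trace_borel S I =
     sigma (infinite_traces S I) {U. openin (infinite_trace_topology S I) U}"

primrec clique_prod ::
    "'a set \<Rightarrow> ('a \<times> 'a) set \<Rightarrow> (nat \<Rightarrow> 'a set) \<Rightarrow> nat \<Rightarrow> 'a list set" where
  "clique_prod S I \<omega> 0 = \<one>\<^bsub>trace_monoid S I\<^esub>"
| "clique_prod S I \<omega> (Suc n) =
     clique_prod S I \<omega> n \<otimes>\<^bsub>trace_monoid S I\<^esub> clique_trace I (\<omega> n)"

definition trace_le_inf ::
    "'a set \<Rightarrow> ('a \<times> 'a) set \<Rightarrow> 'a list set \<Rightarrow> (nat \<Rightarrow> 'a set) \<Rightarrow> bool" where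
  "trace_le_inf S I x \<omega> \<longleftrightarrow> (\<exists>n. trace_le S I x (clique_prod S I \<omega> n))"

definition upset :: "'a set \<Rightarrow> ('a \<times> 'a) set \<Rightarrow> 'a list set \<Rightarrow> (nat \<Rightarrow> 'a set) set" where
  "upset S I x = {\<omega> \<in> infinite_traces S I. trace_le_inf S I x \<omega>}"


section \<open>Concurrent systems\<close>

text \<open>The set \<open>X \<squnion> {\<bottom>}\<close> is the subset \<open>insert None (Some ` X)\<close> of the option type.\<close>

definition concurrent_system ::
    "'a set \<Rightarrow> ('a \<times> 'a) set \<Rightarrow> 'x set \<Rightarrow> ('x option \<Rightarrow> 'a list set \<Rightarrow> 'x option) \<Rightarrow> bool" where
  "concurrent_system S I X act \<longleftrightarrow>
     finite X \<and>
     (\<forall>s \<in> insert None (Some ` X).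
        act s \<one>\<^bsub>trace_monoid S I\<^esub> = s \<and>
        (\<forall>x \<in> carrier (trace_monoid S I).
           act s x \<in> insert None (Some ` X) \<and>
           (\<forall>y \<in> carrier (trace_monoid S I).
              act s (x \<otimes>\<^bsub>trace_monoid S I\<^esub> y) = act (act s x) y))) \<and>
     (\<forall>x \<in> carrier (trace_monoid S I). act None x = None)"

definition enabled_traces ::
    "'a set \<Rightarrow> ('a \<times> 'a) set \<Rightarrow> ('x option \<Rightarrow> 'a list set \<Rightarrow> 'x option) \<Rightarrow> 'x \<Rightarrow> 'a list set set" where
  "enabled_traces S I act \<alpha> = {x \<in> carrier (trace_monoid S I). act (Some \<alpha>) x \<noteq> None}"

definition traces_between ::
    "'a set \<Rightarrow> ('a \<times> 'a) set \<Rightarrow> ('x option \<Rightarrow> 'a list set \<Rightarrow> 'x option) \<Rightarrow> 'x \<Rightarrow> 'x \<Rightarrow> 'a list set set" where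
  "traces_between S I act \<alpha> \<beta> = {x \<in> carrier (trace_monoid S I). act (Some \<alpha>) x = Some \<beta>}"

definition enabled_infinite_traces ::
    "'a set \<Rightarrow> ('a \<times> 'a) set \<Rightarrow> ('x option \<Rightarrow> 'a list set \<Rightarrow> 'x option) \<Rightarrow> 'x \<Rightarrow> (nat \<Rightarrow> 'a set) set" where
  "enabled_infinite_traces S I act \<alpha> =
     {\<omega> \<in> infinite_traces S I.
        \<forall>x \<in> carrier (trace_monoid S I). trace_le_inf S I x \<omega> \<longrightarrow> x \<in> enabled_traces S I act \<alpha>}"

definition irreducible_concurrent_system ::
    "'a set \<Rightarrow> ('a \<times> 'a) set \<Rightarrow> 'x set \<Rightarrow> ('x option \<Rightarrow> 'a list set \<Rightarrow> 'x option) \<Rightarrow> bool" where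
  "irreducible_concurrent_system S I X act \<longleftrightarrow>
     concurrent_system S I X act \<and>
     (\<forall>\<alpha>\<in>X. \<forall>\<beta>\<in>X. traces_between S I act \<alpha> \<beta> \<noteq> {}) \<and>
     (\<exists>\<alpha>\<in>X. \<exists>a\<in>S. act (Some \<alpha>) (trace_of I [a]) \<noteq> None) \<and>
     irreducible_trace_monoid S I \<and>
     (\<forall>\<alpha>\<in>X. \<forall>a\<in>S. \<exists>u \<in> carrier (trace_monoid S I).
        act (Some \<alpha>) (u \<otimes>\<^bsub>trace_monoid S I\<^esub> trace_of I [a]) \<noteq> None)"


section \<open>Valuations and Markov measures\<close>

definition valuation ::
    "'a set \<Rightarrow> ('a \<times> 'a) set \<Rightarrow> 'x set \<Rightarrow> ('x option \<Rightarrow> 'a list set \<Rightarrow> 'x option) \<Rightarrow>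
     ('x \<Rightarrow> 'a list set \<Rightarrow> real) \<Rightarrow> bool" where
  "valuation S I X act f \<longleftrightarrow>
     (\<forall>\<alpha>\<in>X. \<forall>x \<in> carrier (trace_monoid S I).
        0 \<le> f \<alpha> x \<and>
        (0 < f \<alpha> x \<longleftrightarrow> act (Some \<alpha>) x \<noteq> None) \<and>
        (\<forall>y \<in> carrier (trace_monoid S I).
           f \<alpha> (x \<otimes>\<^bsub>trace_monoid S I\<^esub> y) =
             (case act (Some \<alpha>) x of None \<Rightarrow> 0 | Some \<beta> \<Rightarrow> f \<alpha> x * f \<beta> y)))"

definition markov_measure ::
    "'a set \<Rightarrow> ('a \<times> 'a) set \<Rightarrow> 'x set \<Rightarrow> ('x option \<Rightarrow> 'a list set \<Rightarrow> 'x option) \<Rightarrow>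
     ('x \<Rightarrow> (nat \<Rightarrow> 'a set) measure) \<Rightarrow> bool" where
  "markov_measure S I X act m \<longleftrightarrow>
     (\<forall>\<alpha>\<in>X.
        prob_space (m \<alpha>) \<and>
        sets (m \<alpha>) = sets (infinite_trace_borel S I) \<and>
        measure (m \<alpha>) (enabled_infinite_traces S I act \<alpha>) = 1 \<and>
        (\<forall>x \<in> carrier (trace_monoid S I).
           (x \<in> enabled_traces S I act \<alpha> \<longleftrightarrow> 0 < measure (m \<alpha>) (upset S I x)) \<and>
           (\<forall>y \<in> carrier (trace_monoid S I).
              measure (m \<alpha>) (upset S I (x \<otimes>\<^bsub>trace_monoid S I\<^esub> y)) =
                (case act (Some \<alpha>) x of
                   None \<Rightarrow> 0
                 | Some \<beta> \<Rightarrow> measure (m \<alpha>) (upset S I x) * measure (m \<beta>) (upset S I y)))))"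

definition probabilistic_valuation ::
    "'a set \<Rightarrow> ('a \<times> 'a) set \<Rightarrow> 'x set \<Rightarrow> ('x option \<Rightarrow> 'a list set \<Rightarrow> 'x option) \<Rightarrow>
     ('x \<Rightarrow> 'a list set \<Rightarrow> real) \<Rightarrow> bool" where
  "probabilistic_valuation S I X act f \<longleftrightarrow>
     valuation S I X act f \<and>
     (\<exists>m. markov_measure S I X act m \<and>
        (\<forall>\<alpha>\<in>X. \<forall>x \<in> carrier (trace_monoid S I). f \<alpha> x = measure (m \<alpha>) (upset S I x)))"

definition positive_cocycle :: "'x set \<Rightarrow> ('x \<Rightarrow> 'x \<Rightarrow> real) \<Rightarrow> bool" where
  "positive_cocycle X \<Delta> \<longleftrightarrow>
     (\<forall>\<alpha>\<in>X. \<forall>\<beta>\<in>X. 0 < \<Delta> \<alpha> \<beta> \<and> (\<forall>\<gamma>\<in>X. \<Delta> \<alpha> \<gamma> = \<Delta> \<alpha> \<beta> * \<Delta> \<beta> \<gamma>))"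

definition cocycle_valuation ::
    "('x option \<Rightarrow> 'a list set \<Rightarrow> 'x option) \<Rightarrow> real \<Rightarrow> ('x \<Rightarrow> 'x \<Rightarrow> real) \<Rightarrow>
     'x \<Rightarrow> 'a list set \<Rightarrow> real" where
  "cocycle_valuation act \<rho> \<Delta> \<alpha> x =
     (case act (Some \<alpha>) x of None \<Rightarrow> 0 | Some \<beta> \<Rightarrow> \<rho> ^ trace_length x * \<Delta> \<alpha> \<beta>)"

text \<open>For an irreducible concurrent system exactly one pair satisfies this predicate (up to
  the values of \<open>\<Delta>\<close> outside \<open>X \<times> X\<close>), and the Markov measure it induces is the uniform
  measure.\<close>

definition uniform_measure_parameters ::
    "'a set \<Rightarrow> ('a \<times> 'a) set \<Rightarrow> 'x set \<Rightarrow> ('x option \<Rightarrow> 'a list set \<Rightarrow> 'x option) \<Rightarrow>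
     real \<Rightarrow> ('x \<Rightarrow> 'x \<Rightarrow> real) \<Rightarrow> bool" where
  "uniform_measure_parameters S I X act \<rho> \<Delta> \<longleftrightarrow>
     0 < \<rho> \<and> positive_cocycle X \<Delta> \<and>
     probabilistic_valuation S I X act (cocycle_valuation act \<rho> \<Delta>)"


section \<open>The system of cliques\<close>

definition clique_step :: "'a set \<Rightarrow> ('a \<times> 'a) set \<Rightarrow> 'a set \<Rightarrow> 'a \<Rightarrow> 'a set option" where
  "clique_step S I c a =
     (if a \<notin> c \<and> c \<union> {a} \<in> cliques S I then Some (c \<union> {a})
      else if a \<in> c then Some (c - {a})
      else None)"

definition extends_clique_step ::
    "'a set \<Rightarrow> ('a \<times> 'a) set \<Rightarrow> ('a set option \<Rightarrow> 'a list set \<Rightarrow> 'a set option) \<Rightarrow> bool" where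
  "extends_clique_step S I act \<longleftrightarrow>
     (\<forall>c \<in> cliques S I. \<forall>a\<in>S. act (Some c) (trace_of I [a]) = clique_step S I c a)"


section \<open>Well-definedness\<close>

lemma trace_cong_length: "trace_cong I u v \<Longrightarrow> length u = length v"
  by (induction rule: trace_cong.induct) auto

lemma trace_cong_set: "trace_cong I u v \<Longrightarrow> set u = set v"
  by (induction rule: trace_cong.induct) auto

lemma trace_of_eq_iff: "trace_of I u = trace_of I v \<longleftrightarrow> trace_cong I u v"
proof
  assume "trace_of I u = trace_of I v"
  then have "v \<in> trace_of I u"
    using trace_cong.refl[of I v] by (simp only: trace_of_def mem_Collect_eq)
  then show "trace_cong I u v" by (simp only: trace_of_def mem_Collect_eq)
next
  assume "trace_cong I u v"
  then have "trace_cong I u w \<longleftrightarrow> trace_cong I v w" for w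
    by (meson trace_cong.sym trace_cong.trans)
  then show "trace_of I u = trace_of I v" by (simp only: trace_of_def)
qed

lemma self_in_trace_of: "w \<in> trace_of I w"
  by (simp add: trace_of_def trace_cong.refl)

lemma trace_length_trace_of: "trace_length (trace_of I w) = length w"
proof -
  have "(SOME v. v \<in> trace_of I w) \<in> trace_of I w"
    by (rule someI) (rule self_in_trace_of)
  then have "trace_cong I w (SOME v. v \<in> trace_of I w)"
    by (simp only: trace_of_def mem_Collect_eq)
  then show ?thesis
    unfolding trace_length_def by (rule trace_cong_length[symmetric])
qed

lemma trace_mult:
  "trace_of I u \<otimes>\<^bsub>trace_monoid S I\<^esub> trace_of I v = trace_of I (u @ v)"
proof -
  have "trace_of I (u' @ v') = trace_of I (u @ v)"
    if "u' \<in> trace_of I u" "v' \<in> trace_of I v" for u' v'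
    unfolding trace_of_eq_iff
    by (rule trace_cong.sym, rule trace_cong.app) (use that in \<open>simp_all add: trace_of_def\<close>)
  then have "(\<Union>u'\<in>trace_of I u. \<Union>v'\<in>trace_of I v. trace_of I (u' @ v')) = trace_of I (u @ v)"
    using self_in_trace_of[of u I] self_in_trace_of[of v I] by blast
  then show ?thesis
    by (simp add: trace_monoid_def)
qed

lemma trace_one: "\<one>\<^bsub>trace_monoid S I\<^esub> = trace_of I []"
  by (simp add: trace_monoid_def)

lemma trace_carrier: "carrier (trace_monoid S I) = trace_of I ` lists S"
  by (simp add: trace_monoid_def)

lemma monoid_trace_monoid: "monoid (trace_monoid S I)"
proof (rule monoidI)
  fix x y
  assume "x \<in> carrier (trace_monoid S I)" "y \<in> carrier (trace_monoid S I)"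
  then obtain u v where "u \<in> lists S" "v \<in> lists S" "x = trace_of I u" "y = trace_of I v"
    by (auto simp only: trace_carrier image_iff)
  then show "x \<otimes>\<^bsub>trace_monoid S I\<^esub> y \<in> carrier (trace_monoid S I)"
    unfolding trace_carrier by (intro image_eqI[of _ _ "u @ v"]) (auto simp: trace_mult)
next
  show "\<one>\<^bsub>trace_monoid S I\<^esub> \<in> carrier (trace_monoid S I)"
    unfolding trace_carrier trace_one by (rule imageI) simp
next
  fix x y z
  assume "x \<in> carrier (trace_monoid S I)" "y \<in> carrier (trace_monoid S I)"
    "z \<in> carrier (trace_monoid S I)"
  then obtain u v w where "x = trace_of I u" "y = trace_of I v" "z = trace_of I w"
    by (auto simp only: trace_carrier image_iff)
  then show "x \<otimes>\<^bsub>trace_monoid S I\<^esub> y \<otimes>\<^bsub>trace_monoid S I\<^esub> z =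
      x \<otimes>\<^bsub>trace_monoid S I\<^esub> (y \<otimes>\<^bsub>trace_monoid S I\<^esub> z)"
    by (simp only: trace_mult append_assoc)
next
  fix x
  assume "x \<in> carrier (trace_monoid S I)"
  then obtain u where u: "x = trace_of I u"
    by (auto simp only: trace_carrier image_iff)
  show "\<one>\<^bsub>trace_monoid S I\<^esub> \<otimes>\<^bsub>trace_monoid S I\<^esub> x = x"
    by (simp only: u trace_one trace_mult append_Nil)
  show "x \<otimes>\<^bsub>trace_monoid S I\<^esub> \<one>\<^bsub>trace_monoid S I\<^esub> = x"
    by (simp only: u trace_one trace_mult append_Nil2)
qed

lemma clique_trace_set:
  assumes "distinct w" "set w \<in> cliques S I"
  shows "clique_trace I (set w) = trace_of I w"
proof -
  have move: "trace_cong I (u @ [a]) (a # u)" if "\<forall>b\<in>set u. (b, a) \<in> I" for a u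
    using that
  proof (induction u)
    case Nil
    show ?case by (simp add: trace_cong.refl)
  next
    case (Cons b u)
    have "trace_cong I ([b] @ (u @ [a])) ([b] @ (a # u))"
      using Cons by (intro trace_cong.app trace_cong.refl) auto
    moreover have "trace_cong I ([b, a] @ u) ([a, b] @ u)"
      using Cons.prems by (intro trace_cong.app trace_cong.refl trace_cong.swap) auto
    ultimately show ?case using trace_cong.trans by fastforce
  qed
  have perm: "trace_cong I v w"
    if "distinct v" "distinct w" "set v = set w" "\<forall>a\<in>set w. \<forall>b\<in>set w. a \<noteq> b \<longrightarrow> (a, b) \<in> I" for v w
    using that
  proof (induction w arbitrary: v)
    case Nil
    then show ?case by (simp add: trace_cong.refl)
  next
    case (Cons a w)
    then obtain p q where v: "v = p @ a # q"
      by (metis list.set_intros(1) split_list)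
    have "trace_cong I (p @ [a]) (a # p)"
    proof (rule move, rule ballI)
      fix b assume b: "b \<in> set p"
      then have "b \<noteq> a" "b \<in> set (a # w)" using Cons.prems(1,3) v by auto
      then show "(b, a) \<in> I" using Cons.prems(4) by auto
    qed
    then have "trace_cong I ((p @ [a]) @ q) ((a # p) @ q)"
      by (intro trace_cong.app trace_cong.refl)
    moreover have "set (p @ q) = set w"
      using Cons.prems(1-3) v by auto
    then have "trace_cong I (p @ q) w"
      using Cons.prems v by (intro Cons.IH) auto
    then have "trace_cong I ([a] @ (p @ q)) ([a] @ w)"
      by (intro trace_cong.app trace_cong.refl)
    ultimately show ?case using v trace_cong.trans by fastforce
  qed
  have "distinct (SOME v. distinct v \<and> set v = set w) \<and> set (SOME v. distinct v \<and> set v = set w) = set w"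
    using someI[of "\<lambda>v. distinct v \<and> set v = set w" w] assms(1) by simp
  then show ?thesis
    unfolding clique_trace_def trace_of_eq_iff
    using assms by (intro perm) (auto simp: cliques_def)
qed

text \<open>The map of letters extends to one and only one action, and the resulting system is
  irreducible.\<close>

lemma clique_action_unique:
  assumes "concurrent_system S I (cliques S I) act" "extends_clique_step S I act"
    and "concurrent_system S I (cliques S I) act'" "extends_clique_step S I act'"
    and "s \<in> insert None (Some ` cliques S I)" "x \<in> carrier (trace_monoid S I)"
  shows "act s x = act' s x"
proof -
  have letter: "trace_of I [a] \<in> carrier (trace_monoid S I)" if "a \<in> S" for a
    using that by (auto simp: trace_carrier)
  have "act s (trace_of I w) = act' s (trace_of I w)" if "w \<in> lists S" for w
    using that
  proof (induction w rule: rev_induct)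
    case Nil
    then show ?case
      using assms unfolding concurrent_system_def trace_one by metis
  next
    case (snoc a w)
    then have a: "a \<in> S" and w: "trace_of I w \<in> carrier (trace_monoid S I)"
      by (auto simp: trace_carrier)
    have "act s (trace_of I (w @ [a])) = act (act s (trace_of I w)) (trace_of I [a])"
      using assms(1,5) w letter[OF a] unfolding concurrent_system_def
      by (metis trace_mult)
    moreover have "act' s (trace_of I (w @ [a])) = act' (act' s (trace_of I w)) (trace_of I [a])"
      using assms(3,5) w letter[OF a] unfolding concurrent_system_def
      by (metis trace_mult)
    moreover have "act s (trace_of I w) \<in> insert None (Some ` cliques S I)"
      using assms(1,5) w unfolding concurrent_system_def by metis
    moreover have "act t (trace_of I [a]) = act' t (trace_of I [a])"
      if "t \<in> insert None (Some ` cliques S I)" for t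
      using that assms(1-4) a letter[OF a]
      unfolding concurrent_system_def extends_clique_step_def by auto
    ultimately show ?case using snoc by simp
  qed
  then show ?thesis using assms(6) by (auto simp: trace_carrier)
qed

lemma clique_action_exists:
  assumes fin: "finite S" and ne: "S \<noteq> {}" and sub: "I \<subseteq> S \<times> S"
    and irr: "irrefl I" and symI: "sym I" and conn: "irreducible_trace_monoid S I"
  shows "\<exists>act. irreducible_concurrent_system S I (cliques S I) act \<and> extends_clique_step S I act"
proof -
  define st where "st s a = (case s of None \<Rightarrow> None | Some c \<Rightarrow> clique_step S I c a)" for s a
  define X where "X = insert None (Some ` cliques S I)"
  have symD': "(b, a) \<in> I" if "(a, b) \<in> I" for a b
    using that symI by (meson symD)
  have step_C: "d \<in> cliques S I" if "clique_step S I c a = Some d" "c \<in> cliques S I" for c d a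
  proof (cases "a \<in> c")
    case True
    then have "d = c - {a}" using that by (simp add: clique_step_def)
    then show ?thesis using that(2) by (auto simp: cliques_def)
  next
    case False
    then show ?thesis using that by (simp add: clique_step_def split: if_splits)
  qed
  have st_X: "st s a \<in> X" if "s \<in> X" for s a
  proof (cases "st s a")
    case None
    then show ?thesis by (simp add: X_def)
  next
    case (Some d)
    then obtain c where "s = Some c" "clique_step S I c a = Some d"
      by (auto simp: st_def split: option.splits)
    then have "d \<in> cliques S I" using step_C that by (auto simp: X_def)
    then show ?thesis using Some by (simp add: X_def)
  qed
  have fold_X: "foldl st s w \<in> X" if "s \<in> X" for s w
    using that by (induction w arbitrary: s) (auto intro: st_X)
  have st_comm: "st (st s a) b = st (st s b) a" if "s \<in> X" "(a, b) \<in> I" for s a b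
  proof (cases s)
    case None
    then show ?thesis by (simp add: st_def)
  next
    case (Some c)
    then have c: "c \<in> cliques S I" using that by (auto simp: X_def)
    have ab: "a \<noteq> b" "a \<in> S" "b \<in> S" "(a, b) \<in> I" "(b, a) \<in> I"
      using that sub irr symD' by (auto simp: irrefl_def)
    have add: "d \<union> {x} \<in> cliques S I \<longleftrightarrow> x \<in> S \<and> (\<forall>y\<in>d. x \<noteq> y \<longrightarrow> (x, y) \<in> I)"
      if "d \<in> cliques S I" for d x
      using that symD' by (auto simp: cliques_def)
    have del: "d - {x} \<in> cliques S I" if "d \<in> cliques S I" for d x
      using that by (auto simp: cliques_def)
    have step: "clique_step S I d x =
        (if x \<in> d then Some (d - {x})
         else if x \<in> S \<and> (\<forall>y\<in>d. x \<noteq> y \<longrightarrow> (x, y) \<in> I) then Some (insert x d) else None)"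
      if "d \<in> cliques S I" for d x
      unfolding clique_step_def add[OF that] by auto
    have ins: "insert x d \<in> cliques S I"
      if "d \<in> cliques S I" "x \<in> S" "\<forall>y\<in>d. x \<noteq> y \<longrightarrow> (x, y) \<in> I" for d x
      using add[OF that(1)] that by simp
    show ?thesis
    proof (cases "a \<in> c"; cases "b \<in> c")
      assume h: "a \<in> c" "b \<in> c"
      then show ?thesis
        using c ab unfolding Some st_def
        by (simp add: step del Diff_insert[symmetric] insert_commute)
    next
      assume h: "a \<in> c" "b \<notin> c"
      have e: "insert b (c - {a}) = insert b c - {a}" using ab by auto
      have "(\<forall>y\<in>c - {a}. b \<noteq> y \<longrightarrow> (b, y) \<in> I) \<longleftrightarrow> (\<forall>y\<in>c. b \<noteq> y \<longrightarrow> (b, y) \<in> I)"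
        using ab by blast
      then show ?thesis
        using c ab h e unfolding Some st_def by (auto simp add: step del ins)
    next
      assume h: "a \<notin> c" "b \<in> c"
      have e: "insert a (c - {b}) = insert a c - {b}" using ab by auto
      have "(\<forall>y\<in>c - {b}. a \<noteq> y \<longrightarrow> (a, y) \<in> I) \<longleftrightarrow> (\<forall>y\<in>c. a \<noteq> y \<longrightarrow> (a, y) \<in> I)"
        using ab by blast
      then show ?thesis
        using c ab h e unfolding Some st_def by (auto simp add: step del ins)
    next
      assume h: "a \<notin> c" "b \<notin> c"
      then show ?thesis
        using c ab unfolding Some st_def
        by (auto simp add: step ins insert_commute)
    qed
  qed
  have inv: "foldl st s u = foldl st s v" if "trace_cong I u v" "s \<in> X" for s u v
    using that
  proof (induction arbitrary: s rule: trace_cong.induct)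
    case (swap a b)
    then show ?case using st_comm by simp
  qed (auto simp: fold_X)
  define act where "act s x = foldl st s (SOME w. w \<in> x)" for s x
  have act: "act s (trace_of I w) = foldl st s w" if "s \<in> X" for s w
  proof -
    have "(SOME v. v \<in> trace_of I w) \<in> trace_of I w"
      by (rule someI) (rule self_in_trace_of)
    then show ?thesis
      using inv that unfolding act_def trace_of_def by fastforce
  qed
  have "cliques S I \<subseteq> Pow S" by (auto simp: cliques_def)
  then have finC: "finite (cliques S I)" using fin by (simp add: finite_subset)
  have NX: "None \<in> X" by (simp add: X_def)
  have fold_None: "foldl st None w = None" for w
    by (induction w) (auto simp: st_def)
  have cs: "concurrent_system S I (cliques S I) act"
    unfolding concurrent_system_def X_def[symmetric] trace_one trace_carrier
    using finC NX by (auto simp: act trace_mult fold_X fold_None)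
  have ext: "extends_clique_step S I act"
    unfolding extends_clique_step_def by (auto simp: act X_def st_def)
  have st_Some: "st (Some c) a = clique_step S I c a" for c a
    by (simp add: st_def)
  have down: "foldl st (Some c) w = Some (c - set w)" if "distinct w" "set w \<subseteq> c" for c w
    using that
  proof (induction w arbitrary: c)
    case (Cons a w)
    then have "foldl st (Some (c - {a})) w = Some (c - {a} - set w)" by (intro Cons.IH) auto
    moreover have "c - {a} - set w = c - set (a # w)" by auto
    ultimately show ?case using Cons.prems by (simp add: st_Some clique_step_def)
  qed simp
  have up: "foldl st (Some {}) w = Some (set w)" if "distinct w" "set w \<in> cliques S I" for w
    using that
  proof (induction w rule: rev_induct)
    case (snoc a w)
    have "set w \<in> cliques S I" using snoc.prems(2) by (auto simp: cliques_def)
    then have "foldl st (Some {}) w = Some (set w)" using snoc by auto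
    then show ?case using snoc.prems by (simp add: st_Some clique_step_def)
  qed simp
  have enum: "\<exists>w \<in> lists S. distinct w \<and> set w = c" if "c \<in> cliques S I" for c
  proof -
    have "c \<subseteq> S" using that by (simp add: cliques_def)
    then show ?thesis
      using fin finite_distinct_list[of c] by (auto dest: finite_subset)
  qed
  have single: "{a} \<in> cliques S I" if "a \<in> S" for a
    using that by (simp add: cliques_def)
  have empty: "{} \<in> cliques S I" by (simp add: cliques_def)
  have path: "\<exists>w \<in> lists S. foldl st (Some c) w = Some d"
    if cd: "c \<in> cliques S I" "d \<in> cliques S I" for c d
  proof -
    obtain v where v: "v \<in> lists S" "distinct v" "set v = c" using enum[OF cd(1)] by blast
    obtain w where w: "w \<in> lists S" "distinct w" "set w = d" using enum[OF cd(2)] by blast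
    have "foldl st (Some c) (v @ w) = Some d"
      using v w down[of v c] up[of w] cd by simp
    then show ?thesis using v(1) w(1) by (intro bexI[of _ "v @ w"]) auto
  qed
  have SX: "Some c \<in> X" if "c \<in> cliques S I" for c
    using that by (simp add: X_def)
  have c1: "traces_between S I act c d \<noteq> {}" if cd: "c \<in> cliques S I" "d \<in> cliques S I" for c d
  proof -
    obtain w where "w \<in> lists S" "foldl st (Some c) w = Some d" using path[OF cd] by blast
    then have "trace_of I w \<in> traces_between S I act c d"
      using act[OF SX[OF cd(1)]] by (auto simp: traces_between_def trace_carrier)
    then show ?thesis by blast
  qed
  have step0: "foldl st (Some {}) [a] = Some {a}" if "a \<in> S" for a
    using up[of "[a]"] single[OF that] by simp
  obtain a0 where a0: "a0 \<in> S" using ne by blast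
  have c2: "\<exists>c \<in> cliques S I. \<exists>a\<in>S. act (Some c) (trace_of I [a]) \<noteq> None"
    using a0 empty step0[OF a0] act[OF SX[OF empty], of "[a0]"] by (metis option.discI)
  have c3: "\<exists>u \<in> carrier (trace_monoid S I).
      act (Some c) (u \<otimes>\<^bsub>trace_monoid S I\<^esub> trace_of I [a]) \<noteq> None"
    if c: "c \<in> cliques S I" and a: "a \<in> S" for c a
  proof -
    obtain w where w: "w \<in> lists S" "foldl st (Some c) w = Some {}" using path[OF c empty] by blast
    then have "act (Some c) (trace_of I w \<otimes>\<^bsub>trace_monoid S I\<^esub> trace_of I [a]) \<noteq> None"
      using step0[OF a] act[OF SX[OF c]] by (simp add: trace_mult)
    then show ?thesis using w(1) by (auto simp: trace_carrier)
  qed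
  show ?thesis
    using cs ext c1 c2 c3 conn unfolding irreducible_concurrent_system_def by blast
qed

end

theory Submission
  imports Defs
begin

text \<open>Write \<open>t = \<rho>\<^sup>2\<close> and \<open>h \<beta> = \<Delta> {} \<beta>\<close>, and for a sub-alphabet \<open>T\<close> let \<open>\<mu>\<^sub>T\<close> be the Moebius polynomial
  of \<open>T\<close>. The two claims are \<open>h \<beta> = \<rho>\<^bsup>|\<beta>|\<^esup>\<close> and \<open>t = r\<close>. The existence of the measure is used only
  through two inclusion-exclusion sums over events of the form \<open>a\<^sup>k \<le> \<omega>\<close> (lemma
  \<open>inclusion_exclusion_powers\<close>); they are sums over cliques because powers of pairwise independent
  letters have their product as least common multiple, while non-trivial powers of two distinct
  dependent letters have no common multiple.

  With \<open>k = 2\<close>, started in the empty clique: playing \<open>aabb\<dots>\<close> for a clique \<open>c\<close> leads back to the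
  empty clique and has probability \<open>t\<^bsup>|c|\<^esup>\<close>. Hence \<open>\<mu>\<^sub>T(t)\<close> is a probability, namely that no
  \<open>aa\<close> with \<open>a \<in> T\<close> divides \<open>\<omega>\<close>, and \<open>\<mu>\<^sub>T(t) \<ge> 0\<close> for every \<open>T\<close> (\<open>moebius_nonneg\<close>). Irreducibility
  improves this to \<open>\<mu>\<^sub>T(t) > 0\<close> for every proper \<open>T\<close> (\<open>moebius_pos_proper\<close>).

  With \<open>k = 1\<close>, started in \<open>\<alpha>\<close>: some letter divides \<open>\<omega>\<close>, so the sum over all cliques \<open>c\<close> compatible
  with \<open>\<alpha>\<close> of \<open>(-\<rho>)\<^bsup>|c|\<^esup>\<close> times \<open>h\<close> at the symmetric difference of \<open>\<alpha>\<close> and \<open>c\<close> is \<open>0\<close> (\<open>balance\<close>).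
  Normalise \<open>g \<beta> = h \<beta> / \<rho>\<^bsup>|\<beta>|\<^esup>\<close> and let \<open>D\<^sub>\<alpha>\<close> be the iterated difference operator in the directions of
  \<open>\<alpha>\<close>. The equation turns into: the sum over the cliques \<open>\<gamma>\<close> of the link of \<open>\<alpha>\<close> of
  \<open>(-t)\<^bsup>|\<gamma>|\<^esup> (D\<^sub>\<alpha> g)(\<gamma>)\<close> is \<open>0\<close>. This system is triangular: if all differences for cliques larger than
  \<open>\<alpha>\<close> vanish, \<open>D\<^sub>\<alpha> g\<close> is constant on the link, and the equation says that this constant times
  \<open>\<mu>\<^sub>L(t)\<close>, with \<open>L\<close> the link of \<open>\<alpha>\<close>, is \<open>0\<close>. For \<open>\<alpha> \<noteq> {}\<close> the link is a proper sub-alphabet, so the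
  constant is \<open>0\<close> (\<open>diff_sum_vanishes\<close>). Thus \<open>g\<close> is constant, equal to \<open>g {} = 1\<close>, and the equation
  for \<open>\<alpha> = {}\<close> reads \<open>\<mu>(t) = 0\<close>.

  It remains that \<open>\<mu>\<close> has no real root of smaller modulus. All coefficients of \<open>\<mu>(-x)\<close> are non-negative and the
  constant one is \<open>1\<close>, which excludes negative roots. On \<open>[0, t)\<close> the derivative of \<open>\<mu>\<^sub>T\<close> is minus the
  sum of the \<open>\<mu>\<close> of the links in \<open>T\<close> of its letters, so by induction \<open>\<mu>\<^sub>T\<close> is decreasing or constantly \<open>1\<close> there, and
  positive because \<open>\<mu>\<^sub>T(t) \<ge> 0\<close> (\<open>moebius_pos_below\<close>).\<close>

section \<open>Divisibility by powers of letters\<close>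

text \<open>Divisibility of traces is treated on representing words.\<close>

definition word_le :: "('a \<times> 'a) set \<Rightarrow> 'a list \<Rightarrow> 'a list \<Rightarrow> bool" where
  "word_le I u v \<longleftrightarrow> (\<exists>w. trace_cong I v (u @ w))"

definition initial_letter :: "('a \<times> 'a) set \<Rightarrow> 'a \<Rightarrow> 'a list \<Rightarrow> bool" where
  "initial_letter I a v \<longleftrightarrow> a \<in> set v \<and> (\<forall>b \<in> set (takeWhile ((\<noteq>) a) v). (a, b) \<in> I)"

definition power_word :: "nat \<Rightarrow> 'a list \<Rightarrow> 'a list" where
  "power_word k w = concat (map (replicate k) w)"

lemma power_word_Nil [simp]: "power_word k [] = []"
  and power_word_Cons [simp]: "power_word k (a # w) = replicate k a @ power_word k w"
  by (simp_all add: power_word_def)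

lemma length_power_word [simp]: "length (power_word k w) = k * length w"
  by (induction w) (simp_all add: algebra_simps)

lemma power_word_in_lists: "set w \<subseteq> S \<Longrightarrow> power_word k w \<in> lists S"
  by (induction w) auto

lemma power_word_1 [simp]: "power_word 1 w = w"
  by (induction w) simp_all

lemma word_le_cong: "trace_cong I v v' \<Longrightarrow> word_le I u v \<longleftrightarrow> word_le I u v'"
  unfolding word_le_def by (meson trace_cong.sym trace_cong.trans)

lemma trace_le_iff_word_le:
  assumes "v \<in> lists S"
  shows "trace_le S I (trace_of I u) (trace_of I v) \<longleftrightarrow> word_le I u v"
proof
  assume "word_le I u v"
  then obtain w where w: "trace_cong I v (u @ w)" by (auto simp: word_le_def)
  then have "w \<in> lists S" using trace_cong_set[OF w] assms by auto
  then show "trace_le S I (trace_of I u) (trace_of I v)"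
    using w unfolding trace_le_def trace_carrier by (auto simp: trace_mult trace_of_eq_iff)
qed (auto simp: trace_le_def trace_carrier trace_mult trace_of_eq_iff word_le_def)

lemma trace_cong_remove1: "trace_cong I u v \<Longrightarrow> trace_cong I (remove1 a u) (remove1 a v)"
proof (induction rule: trace_cong.induct)
  case (app u u' v v')
  then show ?case
    using trace_cong_set[OF app(1)]
    by (auto simp: remove1_append intro: trace_cong.app)
qed (auto intro: trace_cong.intros)

locale independence =
  fixes S :: "'a set" and I :: "('a \<times> 'a) set"
  assumes fin: "finite S" and I_sub: "I \<subseteq> S \<times> S" and irr: "irrefl I" and symI: "sym I"
begin

lemma I_sym: "(a, b) \<in> I \<Longrightarrow> (b, a) \<in> I"
  using symI by (meson symD)

lemma I_irrefl [simp]: "(a, a) \<notin> I"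
  using irr by (simp add: irrefl_def)

lemma initial_letter_append:
  "initial_letter I a (u @ v) \<longleftrightarrow>
     initial_letter I a u \<or> (\<forall>b \<in> set u. (a, b) \<in> I) \<and> initial_letter I a v"
proof (cases "a \<in> set u")
  case True
  then show ?thesis by (auto simp: initial_letter_def)
next
  case False
  then have "takeWhile ((\<noteq>) a) (u @ v) = u @ takeWhile ((\<noteq>) a) v"
    by (intro takeWhile_append2) auto
  then show ?thesis using False by (auto simp: initial_letter_def)
qed

lemma initial_letter_Cons [simp]:
  "initial_letter I a (b # v) \<longleftrightarrow> a = b \<or> (a, b) \<in> I \<and> initial_letter I a v"
  by (auto simp: initial_letter_def)

lemma initial_letter_Nil [simp]: "\<not> initial_letter I a []"
  by (simp add: initial_letter_def)

lemma initial_letter_cong: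
  "trace_cong I u v \<Longrightarrow> initial_letter I a u \<longleftrightarrow> initial_letter I a v"
proof (induction rule: trace_cong.induct)
  case (swap b c)
  then show ?case using I_sym by auto
next
  case (app u u' v v')
  then show ?case
    using trace_cong_set[OF app(1)] by (simp add: initial_letter_append)
qed auto

lemma initial_letter_front:
  assumes "initial_letter I a v"
  shows "trace_cong I v (a # remove1 a v)"
  using assms
proof (induction v)
  case (Cons b v)
  show ?case
  proof (cases "a = b")
    case True
    then show ?thesis by (simp add: trace_cong.refl)
  next
    case False
    then have ab: "(b, a) \<in> I" and "initial_letter I a v"
      using Cons.prems I_sym by auto
    then have "trace_cong I ([b] @ v) ([b] @ a # remove1 a v)"
      using Cons.IH by (intro trace_cong.app trace_cong.refl) auto
    moreover have "trace_cong I ([b, a] @ remove1 a v) ([a, b] @ remove1 a v)"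
      using ab by (intro trace_cong.app trace_cong.refl trace_cong.swap)
    ultimately show ?thesis using False trace_cong.trans by fastforce
  qed
qed simp

text \<open>Left division by a letter can be read off any word: the first occurrence of the letter has
  to commute with everything before it, and deleting it gives the quotient. Both
  conditions depend on the trace only, which also makes left division by a letter cancellative.\<close>

lemma word_le_Cons:
  "word_le I (a # u) v \<longleftrightarrow> initial_letter I a v \<and> word_le I u (remove1 a v)"
proof
  assume "word_le I (a # u) v"
  then obtain w where w: "trace_cong I v (a # u @ w)" by (auto simp: word_le_def)
  then have "trace_cong I (remove1 a v) (u @ w)"
    using trace_cong_remove1[OF w, of a] by simp
  then show "initial_letter I a v \<and> word_le I u (remove1 a v)"
    using initial_letter_cong[OF w] by (auto simp: word_le_def)
next
  assume h: "initial_letter I a v \<and> word_le I u (remove1 a v)"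
  then obtain w where "trace_cong I (remove1 a v) (u @ w)" by (auto simp: word_le_def)
  then have "trace_cong I ([a] @ remove1 a v) ([a] @ u @ w)"
    by (intro trace_cong.app trace_cong.refl)
  then have "trace_cong I v (a # u @ w)"
    using initial_letter_front h trace_cong.trans by fastforce
  then show "word_le I (a # u) v" by (auto simp: word_le_def)
qed

lemma word_le_Nil [simp]: "word_le I [] v"
  by (auto simp: word_le_def intro: trace_cong.refl)

lemma initial_letters_independent:
  assumes "initial_letter I a v" "initial_letter I b v" "a \<noteq> b"
  shows "(a, b) \<in> I"
  using initial_letter_cong[OF initial_letter_front[OF assms(1)], of b] assms I_sym by auto

lemma word_le_replicate_Cons:
  assumes "(a, b) \<in> I"
  shows "word_le I (replicate k b) (a # v) \<longleftrightarrow> word_le I (replicate k b) v"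
proof (induction k arbitrary: v)
  case (Suc k)
  have "a \<noteq> b" using assms by auto
  then show ?case using assms Suc I_sym by (auto simp: word_le_Cons)
qed simp

lemma word_le_replicate_append:
  assumes "(a, b) \<in> I"
  shows "word_le I (replicate k b) (replicate l a @ v) \<longleftrightarrow> word_le I (replicate k b) v"
  using assms by (induction l) (simp_all add: word_le_replicate_Cons)

text \<open>Powers of pairwise independent letters have their product as least common multiple. The
  factor of one letter can be split off because a power of an independent letter divides
  \<open>a\<^sup>k v\<close> iff it divides \<open>v\<close>.\<close>

lemma word_le_power_word:
  assumes "distinct w" "\<forall>a\<in>set w. \<forall>b\<in>set w. a \<noteq> b \<longrightarrow> (a, b) \<in> I"
  shows "word_le I (power_word k w) v \<longleftrightarrow> (\<forall>b\<in>set w. word_le I (replicate k b) v)"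
  using assms
proof (induction w arbitrary: v)
  case (Cons a w)
  have indep: "(a, b) \<in> I" if "b \<in> set w" for b
    using Cons.prems that by auto
  have IH: "word_le I (power_word k w) y \<longleftrightarrow> (\<forall>b\<in>set w. word_le I (replicate k b) y)" for y
    using Cons by auto
  show ?case
  proof
    assume "word_le I (power_word k (a # w)) v"
    then obtain z where z: "trace_cong I v (replicate k a @ power_word k w @ z)"
      by (auto simp: word_le_def)
    have "word_le I (power_word k w) (power_word k w @ z)"
      by (auto simp: word_le_def intro: trace_cong.refl)
    then have "word_le I (replicate k b) v" if "b \<in> set w" for b
      unfolding word_le_cong[OF z] word_le_replicate_append[OF indep[OF that]]
      using IH that by blast
    moreover have "word_le I (replicate k a) v" using z by (auto simp: word_le_def)
    ultimately show "\<forall>b\<in>set (a # w). word_le I (replicate k b) v" by simp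
  next
    assume h: "\<forall>b\<in>set (a # w). word_le I (replicate k b) v"
    then obtain y where y: "trace_cong I v (replicate k a @ y)" by (auto simp: word_le_def)
    have "word_le I (power_word k w) y"
      unfolding IH using h word_le_replicate_append[OF indep] word_le_cong[OF y] by auto
    then obtain z where "trace_cong I y (power_word k w @ z)" by (auto simp: word_le_def)
    then have "trace_cong I (replicate k a @ y) (replicate k a @ power_word k w @ z)"
      by (intro trace_cong.app trace_cong.refl)
    then show "word_le I (power_word k (a # w)) v"
      using y trace_cong.trans by (fastforce simp: word_le_def)
  qed
qed simp

section \<open>Infinite traces above a power\<close>

lemma finite_cliques: "T \<subseteq> S \<Longrightarrow> finite (cliques T I)"
  by (rule finite_subset[of _ "Pow S"]) (auto simp: cliques_def fin)

definition enum :: "'a set \<Rightarrow> 'a list" where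
  "enum c = (SOME w. distinct w \<and> set w = c)"

lemma enum: "c \<subseteq> S \<Longrightarrow> distinct (enum c) \<and> set (enum c) = c"
proof -
  assume "c \<subseteq> S"
  then have "\<exists>w. distinct w \<and> set w = c"
    using finite_distinct_list[of c] finite_subset[OF _ fin] by blast
  then show ?thesis unfolding enum_def by (rule someI_ex)
qed

lemma length_enum: "c \<subseteq> S \<Longrightarrow> length (enum c) = card c"
  using enum distinct_card by metis

lemma clique_trace_enum: "clique_trace I c = trace_of I (enum c)"
  by (simp add: clique_trace_def enum_def)

primrec prefix_word :: "(nat \<Rightarrow> 'a set) \<Rightarrow> nat \<Rightarrow> 'a list" where
  "prefix_word \<omega> 0 = []"
| "prefix_word \<omega> (Suc n) = prefix_word \<omega> n @ enum (\<omega> n)"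

lemma clique_prod_prefix_word: "clique_prod S I \<omega> n = trace_of I (prefix_word \<omega> n)"
  by (induction n) (simp_all add: trace_one trace_mult clique_trace_enum)

lemma prefix_word_in_lists:
  assumes "\<omega> \<in> infinite_traces S I" shows "prefix_word \<omega> n \<in> lists S"
proof (induction n)
  case (Suc n)
  have "\<omega> n \<subseteq> S" using assms by (auto simp: infinite_traces_def cliques_def)
  then show ?case using Suc enum by fastforce
qed simp

lemma prefix_word_mono:
  assumes "n \<le> m" shows "\<exists>w. prefix_word \<omega> m = prefix_word \<omega> n @ w"
  using assms by (induction m rule: dec_induct) auto

lemma upset_iff:
  assumes "\<omega> \<in> infinite_traces S I"
  shows "\<omega> \<in> upset S I (trace_of I u) \<longleftrightarrow> (\<exists>n. word_le I u (prefix_word \<omega> n))"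
  using assms
  by (simp add: upset_def trace_le_inf_def clique_prod_prefix_word
      trace_le_iff_word_le prefix_word_in_lists)

lemma word_le_prefix_word_mono:
  assumes "word_le I u (prefix_word \<omega> n)" "n \<le> m"
  shows "word_le I u (prefix_word \<omega> m)"
proof -
  obtain w z where w: "prefix_word \<omega> m = prefix_word \<omega> n @ w"
    and z: "trace_cong I (prefix_word \<omega> n) (u @ z)"
    using assms prefix_word_mono unfolding word_le_def by blast
  have "trace_cong I (prefix_word \<omega> n @ w) ((u @ z) @ w)"
    using z by (intro trace_cong.app trace_cong.refl)
  then show ?thesis unfolding w word_le_def by auto
qed

lemma upset_subset: "upset S I x \<subseteq> infinite_traces S I"
  by (auto simp: upset_def)

text \<open>The letters of a clique reach their powers at different depths of \<open>\<omega>\<close>; as a clique is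
  finite, a common depth exists.\<close>

lemma upset_power_word:
  assumes "c \<in> cliques S I" "c \<noteq> {}"
  shows "(\<Inter>a\<in>c. upset S I (trace_of I (replicate k a))) =
    upset S I (trace_of I (power_word k (enum c)))"
proof -
  have c: "c \<subseteq> S" "finite c" "\<forall>a\<in>c. \<forall>b\<in>c. a \<noteq> b \<longrightarrow> (a, b) \<in> I"
    using assms fin by (auto simp: cliques_def dest: finite_subset)
  have e: "distinct (enum c)" "set (enum c) = c" using enum c by auto
  have le: "word_le I (power_word k (enum c)) v \<longleftrightarrow> (\<forall>b\<in>c. word_le I (replicate k b) v)" for v
    using word_le_power_word[of "enum c" k v] e c by auto
  have "(\<forall>a\<in>c. \<exists>n. word_le I (replicate k a) (prefix_word \<omega> n)) \<longleftrightarrow>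
      (\<exists>n. \<forall>a\<in>c. word_le I (replicate k a) (prefix_word \<omega> n))" for \<omega>
  proof
    assume "\<forall>a\<in>c. \<exists>n. word_le I (replicate k a) (prefix_word \<omega> n)"
    then obtain N where N: "word_le I (replicate k a) (prefix_word \<omega> (N a))" if "a \<in> c" for a
      by metis
    have "word_le I (replicate k a) (prefix_word \<omega> (Max (N ` c)))" if "a \<in> c" for a
      using N[OF that] by (rule word_le_prefix_word_mono) (use that c in auto)
    then show "\<exists>n. \<forall>a\<in>c. word_le I (replicate k a) (prefix_word \<omega> n)" by blast
  qed blast
  then have "(\<forall>a\<in>c. \<omega> \<in> upset S I (trace_of I (replicate k a))) \<longleftrightarrow>
      \<omega> \<in> upset S I (trace_of I (power_word k (enum c)))" if "\<omega> \<in> infinite_traces S I" for \<omega>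
    unfolding upset_iff[OF that] le by simp
  moreover have "(\<Inter>a\<in>c. upset S I (trace_of I (replicate k a))) \<subseteq> infinite_traces S I"
    using assms(2) upset_subset by fastforce
  ultimately show ?thesis using upset_subset by blast
qed

lemma upset_power_disjoint:
  assumes "a \<noteq> b" "(a, b) \<notin> I" "k \<noteq> 0"
  shows "upset S I (trace_of I (replicate k a)) \<inter> upset S I (trace_of I (replicate k b)) = {}"
proof -
  obtain l where k: "k = Suc l" using assms(3) by (cases k) auto
  have False if \<omega>: "\<omega> \<in> infinite_traces S I" and ab: "\<omega> \<in> upset S I (trace_of I (replicate k a))"
    "\<omega> \<in> upset S I (trace_of I (replicate k b))" for \<omega>
  proof -
    obtain n m where "word_le I (replicate k a) (prefix_word \<omega> n)"
      "word_le I (replicate k b) (prefix_word \<omega> m)"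
      using ab unfolding upset_iff[OF \<omega>] by blast
    then have "word_le I (replicate k a) (prefix_word \<omega> (max n m))"
      "word_le I (replicate k b) (prefix_word \<omega> (max n m))"
      by (auto intro: word_le_prefix_word_mono)
    then have "initial_letter I a (prefix_word \<omega> (max n m))"
      "initial_letter I b (prefix_word \<omega> (max n m))"
      by (auto simp: k word_le_Cons)
    then show False using initial_letters_independent assms by blast
  qed
  then show ?thesis using upset_subset by blast
qed

lemma upset_letters_cover: "(\<Union>a\<in>S. upset S I (trace_of I [a])) = infinite_traces S I"
proof -
  have "\<exists>a\<in>S. \<omega> \<in> upset S I (trace_of I [a])" if \<omega>: "\<omega> \<in> infinite_traces S I" for \<omega>
  proof -
    have c: "\<omega> 0 \<in> cliques S I" "\<omega> 0 \<noteq> {}" using \<omega> by (auto simp: infinite_traces_def)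
    then have sub: "\<omega> 0 \<subseteq> S" by (auto simp: cliques_def)
    have "enum (\<omega> 0) \<noteq> []" using enum[OF sub] c by force
    then obtain a w where a: "enum (\<omega> 0) = a # w" by (cases "enum (\<omega> 0)") auto
    then have "a \<in> S" using enum[OF sub] sub by auto
    moreover have "word_le I [a] (prefix_word \<omega> 1)"
      by (simp add: a word_le_Cons)
    ultimately show ?thesis using upset_iff[OF \<omega>] by blast
  qed
  then show ?thesis using upset_subset by blast
qed

lemma prefix_word_cong: "(\<And>i. i < n \<Longrightarrow> \<omega> i = \<omega>' i) \<Longrightarrow> prefix_word \<omega> n = prefix_word \<omega>' n"
  by (induction n) auto

text \<open>Whether \<open>u\<close> divides one of the first \<open>n\<close> products depends on \<open>n\<close> coordinates only, so each
  point of the set has a cylinder around it.\<close>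

lemma openin_upset: "openin (infinite_trace_topology S I) (upset S I (trace_of I u))"
proof -
  let ?P = "product_topology (\<lambda>_::nat. discrete_topology (cliques S I)) UNIV"
  have "\<exists>U. openin ?P U \<and> \<omega> \<in> U \<and> U \<inter> infinite_traces S I \<subseteq> upset S I (trace_of I u)"
    if above: "\<omega> \<in> upset S I (trace_of I u)" for \<omega>
  proof -
    have \<omega>: "\<omega> \<in> infinite_traces S I" using above upset_subset by blast
    obtain n where n: "word_le I u (prefix_word \<omega> n)"
      using above unfolding upset_iff[OF \<omega>] by blast
    define U where "U = (\<Pi>\<^sub>E i\<in>UNIV. if i < n then {\<omega> i} else cliques S I)"
    have C: "\<omega> i \<in> cliques S I" for i using \<omega> by (auto simp: infinite_traces_def)
    have "{i. (if i < n then {\<omega> i} else cliques S I) \<noteq> cliques S I} \<subseteq> {..<n}" by auto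
    then have "finite {i. (if i < n then {\<omega> i} else cliques S I) \<noteq> cliques S I}"
      by (rule finite_subset) simp
    then have "openin ?P U"
      unfolding U_def using C by (intro product_topology_basis) auto
    moreover have "\<omega> \<in> U" using C by (auto simp: U_def)
    moreover have "\<omega>' \<in> upset S I (trace_of I u)" if "\<omega>' \<in> U" "\<omega>' \<in> infinite_traces S I" for \<omega>'
    proof -
      have "\<omega>' i = \<omega> i" if "i < n" for i
        using PiE_mem[OF \<open>\<omega>' \<in> U\<close>[unfolded U_def], of i] that by simp
      then have "prefix_word \<omega>' n = prefix_word \<omega> n" by (rule prefix_word_cong)
      then show ?thesis using n upset_iff \<open>\<omega>' \<in> infinite_traces S I\<close> by metis
    qed
    ultimately show ?thesis by blast
  qed
  note nbhd = this
  define V where "V = \<Union>{U. openin ?P U \<and> U \<inter> infinite_traces S I \<subseteq> upset S I (trace_of I u)}"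
  have "openin ?P V" unfolding V_def by (rule openin_Union) simp
  moreover have "upset S I (trace_of I u) = V \<inter> infinite_traces S I"
  proof
    show "upset S I (trace_of I u) \<subseteq> V \<inter> infinite_traces S I"
    proof
      fix \<omega> assume "\<omega> \<in> upset S I (trace_of I u)"
      then show "\<omega> \<in> V \<inter> infinite_traces S I"
        using nbhd upset_subset unfolding V_def by blast
    qed
  qed (auto simp: V_def)
  ultimately show ?thesis
    unfolding infinite_trace_topology_def openin_subtopology by blast
qed

lemma openin_infinite_traces:
  "{U. openin (infinite_trace_topology S I) U} \<subseteq> Pow (infinite_traces S I)"
  by (auto simp: infinite_trace_topology_def openin_subtopology)

lemma sets_upset: "upset S I (trace_of I u) \<in> sets (infinite_trace_borel S I)"
  unfolding infinite_trace_borel_def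
  using openin_upset by (intro in_measure_of openin_infinite_traces) simp

lemma space_borel: "space (infinite_trace_borel S I) = infinite_traces S I"
  unfolding infinite_trace_borel_def using openin_infinite_traces by (rule space_measure_of)

text \<open>In the inclusion-exclusion sum, a set of letters that is not a clique contributes nothing:
  no infinite trace lies above powers of two distinct dependent letters. The empty clique
  accounts for the \<open>1\<close>.\<close>

lemma inclusion_exclusion_powers:
  assumes "prob_space M" "sets M = sets (infinite_trace_borel S I)" "T \<subseteq> S" "k \<noteq> 0"
  shows "1 - measure M (\<Union>a\<in>T. upset S I (trace_of I (replicate k a))) =
    (\<Sum>c\<in>cliques T I. (-1) ^ card c * measure M (upset S I (trace_of I (power_word k (enum c)))))"
proof -
  interpret prob_space M by fact
  define A where "A a = upset S I (trace_of I (replicate k a))" for a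
  have A: "A a \<in> sets M" for a using sets_upset assms(2) by (simp add: A_def)
  have finT: "finite T" using assms(3) fin finite_subset by blast
  have space: "space M = infinite_traces S I"
    using sets_eq_imp_space_eq[OF assms(2)] space_borel by simp
  interpret Incl_Excl "\<lambda>B. B \<in> sets M" "measure M"
    by unfold_locales (auto simp: finite_measure_Union disjnt_def)
  have "measure M (\<Union>a\<in>T. A a) =
      (\<Sum>B | B \<subseteq> T \<and> B \<noteq> {}. (- 1) ^ (card B + 1) * measure M (\<Inter>a\<in>B. A a))"
    using restricted_indexed[OF finT, of A] A by simp
  also have "\<dots> = (\<Sum>B\<in>cliques T I - {{}}. (- 1) ^ (card B + 1) * measure M (\<Inter>a\<in>B. A a))"
  proof (rule sum.mono_neutral_right)
    show "\<forall>B\<in>{B. B \<subseteq> T \<and> B \<noteq> {}} - (cliques T I - {{}}).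
        (- 1) ^ (card B + 1) * measure M (\<Inter>a\<in>B. A a) = 0"
    proof
      fix B assume "B \<in> {B. B \<subseteq> T \<and> B \<noteq> {}} - (cliques T I - {{}})"
      then obtain a b where "a \<in> B" "b \<in> B" "a \<noteq> b" "(a, b) \<notin> I"
        by (auto simp: cliques_def)
      then have "(\<Inter>a\<in>B. A a) \<subseteq> A a \<inter> A b" "A a \<inter> A b = {}"
        using upset_power_disjoint[of a b k] assms(4) unfolding A_def by auto
      then have "(\<Inter>a\<in>B. A a) = {}" by blast
      then show "(- 1) ^ (card B + 1) * measure M (\<Inter>a\<in>B. A a) = 0" by simp
    qed
  qed (use finT in \<open>auto simp: cliques_def\<close>)
  also have "\<dots> = - (\<Sum>c\<in>cliques T I - {{}}.
      (- 1) ^ card c * measure M (upset S I (trace_of I (power_word k (enum c)))))"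
    unfolding sum_negf[symmetric]
  proof (rule sum.cong)
    fix c assume c: "c \<in> cliques T I - {{}}"
    then have "c \<in> cliques S I" "c \<noteq> {}" using assms(3) by (auto simp: cliques_def)
    then show "(- 1) ^ (card c + 1) * measure M (\<Inter>a\<in>c. A a) =
        - ((- 1) ^ card c * measure M (upset S I (trace_of I (power_word k (enum c)))))"
      unfolding A_def by (simp add: upset_power_word)
  qed simp
  finally have "1 - measure M (\<Union>a\<in>T. A a) = 1 + (\<Sum>c\<in>cliques T I - {{}}.
      (- 1) ^ card c * measure M (upset S I (trace_of I (power_word k (enum c)))))"
    by simp
  moreover have "{} \<in> cliques T I" by (simp add: cliques_def)
  moreover have "measure M (upset S I (trace_of I (power_word k (enum {})))) = 1"
  proof -
    have "enum {} = []" using enum[of "{}"] by simp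
    moreover have "upset S I (trace_of I []) = space M"
      using upset_iff[of _ "[]"] upset_subset unfolding space by auto
    ultimately show ?thesis by (simp add: prob_space)
  qed
  ultimately show ?thesis
    unfolding A_def[symmetric] using finite_cliques[OF assms(3)]
    by (subst sum.remove[of _ "{}"]) simp_all
qed

section \<open>Moebius polynomials of sub-alphabets\<close>

definition moebius :: "'a set \<Rightarrow> real \<Rightarrow> real" where
  "moebius T x = (\<Sum>c\<in>cliques T I. (- x) ^ card c)"

definition link :: "'a set \<Rightarrow> 'a set" where
  "link c = {b \<in> S. \<forall>a\<in>c. (a, b) \<in> I}"

lemma link_empty [simp]: "link {} = S"
  by (simp add: link_def)

lemma finite_clique: "c \<in> cliques T I \<Longrightarrow> T \<subseteq> S \<Longrightarrow> finite c"
  using fin by (auto simp: cliques_def intro: finite_subset)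

lemma insert_clique_iff:
  assumes "b \<in> T" "b \<notin> c" "T \<subseteq> S"
  shows "insert b c \<in> cliques T I \<longleftrightarrow> c \<in> cliques (T \<inter> link {b}) I"
  using assms I_sym by (auto simp: cliques_def link_def)

lemma sum_cliques_containing:
  assumes "b \<in> T" "T \<subseteq> S"
  shows "(\<Sum>c | c \<in> cliques T I \<and> b \<in> c. f c) = (\<Sum>c\<in>cliques (T \<inter> link {b}) I. f (insert b c))"
proof (rule sum.reindex_bij_witness[of _ "insert b" "\<lambda>c. c - {b}"])
  fix c assume c: "c \<in> {c \<in> cliques T I. b \<in> c}"
  then show "c - {b} \<in> cliques (T \<inter> link {b}) I"
    using insert_clique_iff[of b T "c - {b}"] assms by (auto simp: insert_absorb)
  show "insert b (c - {b}) = c" using c by auto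
  show "f (insert b (c - {b})) = f c" using c by (simp add: insert_absorb)
next
  fix c assume c: "c \<in> cliques (T \<inter> link {b}) I"
  then have nb: "b \<notin> c" by (auto simp: cliques_def link_def)
  then show "insert b c - {b} = c" by auto
  show "insert b c \<in> {c \<in> cliques T I. b \<in> c}"
    using insert_clique_iff[OF assms(1) nb assms(2)] c by auto
qed

lemma moebius_empty [simp]: "moebius {} x = 1"
proof -
  have "cliques {} I = {{}}" by (auto simp: cliques_def)
  then show ?thesis by (simp add: moebius_def)
qed

lemma card_insert_link:
  "c \<in> cliques (T \<inter> link {b}) I \<Longrightarrow> card (insert b c) = Suc (card c)"
proof -
  assume c: "c \<in> cliques (T \<inter> link {b}) I"
  then have "b \<notin> c" by (auto simp: cliques_def link_def)
  moreover have "finite c" using c by (rule finite_clique) (auto simp: link_def)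
  ultimately show ?thesis by simp
qed

lemma moebius_insert:
  assumes "b \<in> S" "b \<notin> T" "T \<subseteq> S"
  shows "moebius (insert b T) x = moebius T x - x * moebius (T \<inter> link {b}) x"
proof -
  let ?T = "insert b T"
  have sub: "?T \<subseteq> S" using assms by auto
  have e: "?T \<inter> link {b} = T \<inter> link {b}" by (auto simp: link_def)
  have "moebius ?T x = (\<Sum>c | c \<in> cliques ?T I \<and> b \<in> c. (- x) ^ card c)
      + (\<Sum>c | c \<in> cliques ?T I \<and> b \<notin> c. (- x) ^ card c)"
    unfolding moebius_def using finite_cliques[OF sub]
    by (subst sum.union_disjoint[symmetric]) (auto intro!: sum.cong)
  moreover have "{c. c \<in> cliques ?T I \<and> b \<notin> c} = cliques T I"
    using assms by (auto simp: cliques_def)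
  moreover have "(\<Sum>c | c \<in> cliques ?T I \<and> b \<in> c. (- x) ^ card c) =
      (\<Sum>c\<in>cliques (?T \<inter> link {b}) I. (- x) ^ Suc (card c))"
    unfolding sum_cliques_containing[OF insertI1 sub]
    by (intro sum.cong HOL.refl) (auto dest!: card_insert_link)
  ultimately show ?thesis
    unfolding e by (simp add: moebius_def sum_distrib_left sum_negf)
qed

lemma moebius_has_derivative:
  assumes "T \<subseteq> S"
  shows "(moebius T has_real_derivative - (\<Sum>b\<in>T. moebius (T \<inter> link {b}) x)) (at x)"
proof -
  have finT: "finite T" using assms fin finite_subset by blast
  have "((\<lambda>x. \<Sum>c\<in>cliques T I. (- x) ^ card c) has_real_derivative
      (\<Sum>c\<in>cliques T I. - (real (card c) * (- x) ^ (card c - 1)))) (at x)"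
    by (intro DERIV_sum) (auto intro!: derivative_eq_intros)
  moreover have "(\<Sum>c\<in>cliques T I. real (card c) * (- x) ^ (card c - 1)) =
      (\<Sum>b\<in>T. moebius (T \<inter> link {b}) x)"
  proof -
    have "(\<Sum>c\<in>cliques T I. real (card c) * (- x) ^ (card c - 1)) =
        (\<Sum>c\<in>cliques T I. \<Sum>b\<in>T. if b \<in> c then (- x) ^ (card c - 1) else 0)"
    proof (rule sum.cong[OF HOL.refl])
      fix c assume "c \<in> cliques T I"
      then have "T \<inter> {b. b \<in> c} = c" by (auto simp: cliques_def)
      then show "real (card c) * (- x) ^ (card c - 1) =
          (\<Sum>b\<in>T. if b \<in> c then (- x) ^ (card c - 1) else 0)"
        using finT by (simp add: sum.If_cases)
    qed
    also have "\<dots> = (\<Sum>b\<in>T. \<Sum>c\<in>cliques T I. if b \<in> c then (- x) ^ (card c - 1) else 0)"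
      by (rule sum.swap)
    also have "\<dots> = (\<Sum>b\<in>T. \<Sum>c | c \<in> cliques T I \<and> b \<in> c. (- x) ^ (card c - 1))"
      using finite_cliques[OF assms] by (intro sum.cong HOL.refl sum.inter_filter[symmetric])
    also have "\<dots> = (\<Sum>b\<in>T. moebius (T \<inter> link {b}) x)"
    proof (rule sum.cong[OF HOL.refl])
      fix b assume "b \<in> T"
      show "(\<Sum>c | c \<in> cliques T I \<and> b \<in> c. (- x) ^ (card c - 1)) = moebius (T \<inter> link {b}) x"
        unfolding sum_cliques_containing[OF \<open>b \<in> T\<close> assms] moebius_def
        by (intro sum.cong HOL.refl) (auto dest!: card_insert_link)
    qed
    finally show ?thesis .
  qed
  ultimately show ?thesis by (simp add: moebius_def[abs_def] sum_negf)
qed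

text \<open>Shearer's observation: the region where all Moebius values are non-negative is downward
  closed. By induction on \<open>T\<close> the derivative, a negated sum over links, is negative left of \<open>t\<close>.\<close>

lemma moebius_pos_below:
  assumes nonneg: "\<And>T. T \<subseteq> S \<Longrightarrow> 0 \<le> moebius T t"
    and "T \<subseteq> S" "0 \<le> s" "s < t"
  shows "0 < moebius T s"
  using assms(2-)
proof (induction "card T" arbitrary: T s rule: less_induct)
  case less
  show ?case
  proof (cases "T = {}")
    case False
    have finT: "finite T" using less.prems fin finite_subset by blast
    have "moebius T t < moebius T s"
    proof (rule DERIV_neg_imp_decreasing_open[OF \<open>s < t\<close>])
      fix x assume x: "s < x" "x < t"
      have "0 < moebius (T \<inter> link {b}) x" if "b \<in> T" for b
      proof (rule less.hyps)
        have "b \<notin> link {b}" by (simp add: link_def)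
        then have "T \<inter> link {b} \<subset> T" using that by blast
        then show "card (T \<inter> link {b}) < card T" using finT psubset_card_mono by blast
      qed (use less.prems x in auto)
      then have "0 < (\<Sum>b\<in>T. moebius (T \<inter> link {b}) x)"
        using False finT by (intro sum_pos) auto
      then show "\<exists>y. (moebius T has_real_derivative y) (at x) \<and> y < 0"
        using moebius_has_derivative[OF less.prems(1)] by fastforce
    next
      show "continuous_on {s..t} (moebius T)"
        unfolding moebius_def[abs_def] by (intro continuous_intros)
    qed
    then show ?thesis using nonneg[OF less.prems(1)] by simp
  qed simp
qed

text \<open>Irreducibility enters here. If a minimal \<open>T\<close> has value \<open>0\<close>, adding a letter \<open>b\<close> outside
  \<open>T\<close> keeps the value non-negative only if \<open>T\<close> lies in the link of \<open>b\<close>; thus \<open>T\<close> is independent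
  of its complement.\<close>

lemma moebius_pos_proper:
  assumes conn: "irreducible_trace_monoid S I"
    and nonneg: "\<And>T. T \<subseteq> S \<Longrightarrow> 0 \<le> moebius T t"
    and "0 < t" "T \<subset> S"
  shows "0 < moebius T t"
  using assms(4)
proof (induction "card T" arbitrary: T rule: less_induct)
  case less
  have finT: "finite T" using less.prems fin finite_subset by blast
  show ?case
  proof (rule ccontr)
    assume "\<not> 0 < moebius T t"
    then have zero: "moebius T t = 0" using nonneg[of T] less.prems by auto
    then obtain a where a: "a \<in> T" by fastforce
    have outside: "T \<subseteq> link {b}" if b: "b \<in> S - T" for b
    proof (rule ccontr)
      assume "\<not> T \<subseteq> link {b}"
      then have sub: "T \<inter> link {b} \<subset> T" by auto
      have "0 < moebius (T \<inter> link {b}) t"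
        using less.hyps[OF psubset_card_mono[OF finT sub]] sub less.prems by blast
      then have "0 < t * moebius (T \<inter> link {b}) t" using \<open>0 < t\<close> by simp
      moreover have "0 \<le> moebius (insert b T) t" using nonneg b less.prems by blast
      ultimately show False using moebius_insert[of b T t] zero b less.prems by auto
    qed
    have closed: "x \<in> T" if "(a, x) \<in> ((S \<times> S) - I)\<^sup>*" for x
      using that
    proof (induction rule: rtrancl_induct)
      case (step y z)
      then show ?case using outside[of z] I_sym by (auto simp: link_def)
    qed (rule a)
    obtain b where "b \<in> S - T" using less.prems by blast
    then have "b \<in> T"
      using closed conn a less.prems unfolding irreducible_trace_monoid_def by blast
    then show False using \<open>b \<in> S - T\<close> by simp
  qed
qed

lemma poly_mobius_poly: "poly (mobius_poly S I) (of_real x) = of_real (moebius S x)"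
  unfolding mobius_poly_def moebius_def by (simp add: poly_sum poly_monom power_minus[of "of_real x"] power_minus[of x])

lemma smallest_modulus_root_eq:
  assumes nonneg: "\<And>T. T \<subseteq> S \<Longrightarrow> 0 \<le> moebius T t"
    and "0 < t" "moebius S t = 0" "smallest_modulus_root (mobius_poly S I) (complex_of_real r)"
  shows "r = t"
proof -
  have root: "moebius S r = 0"
    using assms(4) poly_mobius_poly[of r] by (simp add: smallest_modulus_root_def)
  have "poly (mobius_poly S I) (complex_of_real t) = 0"
    using assms(3) by (simp add: poly_mobius_poly)
  then have le: "\<bar>r\<bar> \<le> t"
    using assms(2,4) unfolding smallest_modulus_root_def by fastforce
  have "\<not> r < 0"
  proof
    assume "r < 0"
    have "{} \<in> cliques S I" by (simp add: cliques_def)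
    then have "0 < moebius S r"
      unfolding moebius_def using \<open>r < 0\<close> finite_cliques by (intro sum_pos) auto
    then show False using root by simp
  qed
  then show ?thesis
    using moebius_pos_below[OF nonneg subset_refl, of r] root le by fastforce
qed

text \<open>This is the iterated difference of \<open>g\<close> at \<open>C\<close> in the directions of \<open>A\<close>, up to sign.\<close>

definition diff_sum :: "('a set \<Rightarrow> real) \<Rightarrow> 'a set \<Rightarrow> 'a set \<Rightarrow> real" where
  "diff_sum g A C = (\<Sum>E\<in>Pow A. (-1) ^ card E * g (C \<union> E))"

lemma diff_sum_insert:
  assumes "finite A" "b \<notin> A"
  shows "diff_sum g (insert b A) C = diff_sum g A C - diff_sum g A (insert b C)"
proof -
  have "diff_sum g (insert b A) C =
      (\<Sum>E\<in>Pow A. (-1) ^ card E * g (C \<union> E)) + (\<Sum>E\<in>insert b ` Pow A. (-1) ^ card E * g (C \<union> E))"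
    unfolding diff_sum_def Pow_insert using assms by (intro sum.union_disjoint) auto
  also have "(\<Sum>E\<in>insert b ` Pow A. (-1) ^ card E * g (C \<union> E)) =
      (\<Sum>E\<in>Pow A. (-1) ^ card (insert b E) * g (C \<union> insert b E))"
  proof (rule sum.reindex_cong[of "insert b"])
    show "inj_on (insert b) (Pow A)" using assms(2) by (auto simp: inj_on_def)
  qed auto
  also have "\<dots> = - diff_sum g A (insert b C)"
    unfolding diff_sum_def sum_negf[symmetric]
  proof (rule sum.cong[OF HOL.refl])
    fix E assume "E \<in> Pow A"
    then have "finite E" "b \<notin> E" using assms finite_subset by auto
    then show "(-1) ^ card (insert b E) * g (C \<union> insert b E) =
        - ((-1) ^ card E * g (insert b C \<union> E))" by simp
  qed
  finally show ?thesis by (simp add: diff_sum_def)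
qed

lemma link_cliques_iff:
  assumes A: "A \<in> cliques S I"
  shows "C \<in> cliques (link A) I \<longleftrightarrow> A \<inter> C = {} \<and> A \<union> C \<in> cliques S I"
proof
  assume C: "C \<in> cliques (link A) I"
  have mix: "(a, b) \<in> I" "(b, a) \<in> I" if "a \<in> A" "b \<in> C" for a b
    using C that I_sym by (auto simp: cliques_def link_def)
  have "A \<inter> C = {}" using mix(1) I_irrefl by blast
  moreover have "A \<union> C \<in> cliques S I"
    using A C mix by (auto simp: cliques_def link_def)
  ultimately show "A \<inter> C = {} \<and> A \<union> C \<in> cliques S I" by blast
next
  assume h: "A \<inter> C = {} \<and> A \<union> C \<in> cliques S I"
  have "(a, b) \<in> I" if "a \<in> A" "b \<in> C" for a b
  proof -
    have "a \<noteq> b" using h that by blast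
    then show ?thesis using h that by (auto simp: cliques_def)
  qed
  then show "C \<in> cliques (link A) I"
    using h by (auto simp: cliques_def link_def)
qed

text \<open>The induction is downward on the size of \<open>A\<close>. Vanishing differences for \<open>insert b A\<close> mean
  that \<open>diff_sum g A\<close> does not change when \<open>b\<close> is added to \<open>C\<close>; being constant on the cliques of
  the link, it can be pulled out of the equation for \<open>A\<close>, leaving the Moebius value of the link as
  its coefficient.\<close>

lemma diff_sum_vanishes:
  assumes "A \<in> cliques S I" "A \<noteq> {}" "C \<in> cliques (link A) I"
    and link_ne: "\<And>A. A \<in> cliques S I \<Longrightarrow> A \<noteq> {} \<Longrightarrow> moebius (link A) t \<noteq> 0"
    and eqs: "\<And>A. A \<in> cliques S I \<Longrightarrow> A \<noteq> {} \<Longrightarrow>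
      (\<Sum>C\<in>cliques (link A) I. (- t) ^ card C * diff_sum g A C) = 0"
  shows "diff_sum g A C = 0"
  using assms(1-3)
proof (induction "card S - card A" arbitrary: A C rule: less_induct)
  case less
  have A: "finite A" "A \<subseteq> S" using less.prems finite_clique by (auto simp: cliques_def)
  have const: "diff_sum g A C = diff_sum g A {}" if "C \<in> cliques (link A) I" for C
  proof -
    have "finite C" using that by (rule finite_clique) (auto simp: link_def)
    then show ?thesis using that
    proof (induction C rule: finite_induct)
      case (insert b C)
      have C: "C \<in> cliques (link A) I" using insert.prems by (auto simp: cliques_def)
      have AbC: "A \<inter> insert b C = {}" "A \<union> insert b C \<in> cliques S I"
        using insert.prems link_cliques_iff[OF less.prems(1)] by auto
      then have b: "b \<notin> A" "b \<in> S" and bA: "insert b A \<in> cliques S I"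
        by (auto simp: cliques_def)
      have "C \<in> cliques (link (insert b A)) I"
        using AbC insert.hyps by (simp add: link_cliques_iff[OF bA])
      moreover have "card S - card (insert b A) < card S - card A"
      proof -
        have "card (insert b A) \<le> card S" using b A fin by (intro card_mono) auto
        then show ?thesis using A b by simp
      qed
      ultimately have "diff_sum g (insert b A) C = 0"
        using less.hyps bA by blast
      then show ?case using diff_sum_insert[OF A(1) b(1)] insert.IH[OF C] by simp
    qed simp
  qed
  have "0 = (\<Sum>C\<in>cliques (link A) I. (- t) ^ card C * diff_sum g A {})"
    using eqs[OF less.prems(1,2)] const by simp
  also have "\<dots> = moebius (link A) t * diff_sum g A {}"
    by (simp add: moebius_def sum_distrib_right)
  finally show ?case using link_ne less.prems const by simp
qed

lemma constant_on_cliques: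
  assumes link_ne: "\<And>A. A \<in> cliques S I \<Longrightarrow> A \<noteq> {} \<Longrightarrow> moebius (link A) t \<noteq> 0"
    and eqs: "\<And>A. A \<in> cliques S I \<Longrightarrow> A \<noteq> {} \<Longrightarrow>
      (\<Sum>C\<in>cliques (link A) I. (- t) ^ card C * diff_sum g A C) = 0"
    and "C \<in> cliques S I"
  shows "g C = g {}"
proof -
  have "finite C" using assms(3) by (rule finite_clique) simp
  then show ?thesis using assms(3)
  proof (induction C rule: finite_induct)
    case (insert b C)
    have b: "{b} \<in> cliques S I" and C: "C \<in> cliques S I"
      using insert.prems by (auto simp: cliques_def)
    have "C \<in> cliques (link {b}) I"
      using insert unfolding link_cliques_iff[OF b] by auto
    then have "diff_sum g {b} C = 0"
      using diff_sum_vanishes[OF b] link_ne eqs by blast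
    moreover have "diff_sum g {b} C = g C - g (insert b C)"
      using diff_sum_insert[of "{}" b g C] by (simp add: diff_sum_def)
    ultimately show ?case using insert.IH[OF C] by simp
  qed simp
qed

text \<open>Each clique \<open>c\<close> compatible with \<open>A\<close> splits into the part inside \<open>A\<close>, recorded by its
  complement \<open>E = A - c\<close>, and the part \<open>C = c - A\<close> in the link; the symmetric difference is then
  \<open>C \<union> E\<close>. A letter of \<open>E\<close> costs a sign and a letter of \<open>C\<close> a factor \<open>-\<rho>\<^sup>2\<close> once \<open>h\<close> is
  normalised.\<close>

lemma sum_compatible_cliques:
  assumes A: "A \<in> cliques S I" and "\<rho> \<noteq> 0"
  shows "(\<Sum>c | c \<in> cliques S I \<and> A \<union> c \<in> cliques S I. (- \<rho>) ^ card c * h ((A - c) \<union> (c - A))) =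
    (- \<rho>) ^ card A * (\<Sum>C\<in>cliques (link A) I.
      (- \<rho>\<^sup>2) ^ card C * diff_sum (\<lambda>c. h c / \<rho> ^ card c) A C)"
proof -
  have finA: "finite A" using A by (rule finite_clique) simp
  let ?g = "\<lambda>c. h c / \<rho> ^ card c"
  have "(\<Sum>c | c \<in> cliques S I \<and> A \<union> c \<in> cliques S I. (- \<rho>) ^ card c * h ((A - c) \<union> (c - A))) =
    (\<Sum>(C, E)\<in>cliques (link A) I \<times> Pow A.
      (- \<rho>) ^ card A * ((- \<rho>\<^sup>2) ^ card C * ((-1) ^ card E * ?g (C \<union> E))))"
  proof (rule sum.reindex_bij_witness[of _ "\<lambda>(C, E). (A - E) \<union> C" "\<lambda>c. (c - A, A - c)"])
    fix c assume c: "c \<in> {c. c \<in> cliques S I \<and> A \<union> c \<in> cliques S I}"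
    then have finc: "finite c" using finite_clique by blast
    show "(case (c - A, A - c) of (C, E) \<Rightarrow> (A - E) \<union> C) = c" by auto
    show "(c - A, A - c) \<in> cliques (link A) I \<times> Pow A"
      using c by (auto simp: link_cliques_iff[OF A])
    have 1: "card c = card (A \<inter> c) + card (c - A)"
      using finc finA by (subst card_Un_disjoint[symmetric]) (auto intro: arg_cong[of _ _ card])
    have 2: "card A = card (A \<inter> c) + card (A - c)"
      using finc finA by (subst card_Un_disjoint[symmetric]) (auto intro: arg_cong[of _ _ card])
    have 3: "card ((c - A) \<union> (A - c)) = card (c - A) + card (A - c)"
      using finc finA by (intro card_Un_disjoint) auto
    have 4: "(A - c) \<union> (c - A) = (c - A) \<union> (A - c)" by auto
    have signs: "(- \<rho>) ^ (i + j) * ((- \<rho>\<^sup>2) ^ k * ((-1) ^ j * (y / \<rho> ^ (k + j)))) = (- \<rho>) ^ (i + k) * y"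
      for i j k and y
    proof -
      have sq: "(- \<rho>\<^sup>2) ^ k = (- \<rho>) ^ k * \<rho> ^ k" and sg: "(- \<rho>) ^ j * (-1) ^ j = \<rho> ^ j"
        by (simp_all add: power2_eq_square flip: power_mult_distrib)
      have "(- \<rho>) ^ (i + j) * ((- \<rho>\<^sup>2) ^ k * ((-1) ^ j * (y / \<rho> ^ (k + j)))) =
          (- \<rho>) ^ (i + k) * y * (((- \<rho>) ^ j * (-1) ^ j) * \<rho> ^ k / \<rho> ^ (k + j))"
        unfolding sq by (simp add: power_add mult_ac)
      then show ?thesis unfolding sg using \<open>\<rho> \<noteq> 0\<close> by (simp add: power_add)
    qed
    have "(- \<rho>) ^ card A * ((- \<rho>\<^sup>2) ^ card (c - A) * ((-1) ^ card (A - c) * ?g ((c - A) \<union> (A - c))))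
        = (- \<rho>) ^ card c * h ((c - A) \<union> (A - c))"
      unfolding 1 2 3 by (rule signs)
    then show "(case (c - A, A - c) of (C, E) \<Rightarrow>
        (- \<rho>) ^ card A * ((- \<rho>\<^sup>2) ^ card C * ((-1) ^ card E * ?g (C \<union> E)))) =
        (- \<rho>) ^ card c * h ((A - c) \<union> (c - A))"
      unfolding 4 by simp
  next
    fix x assume "x \<in> cliques (link A) I \<times> Pow A"
    then obtain C E where x: "x = (C, E)" "C \<in> cliques (link A) I" "E \<subseteq> A" by auto
    then have C: "A \<inter> C = {}" "A \<union> C \<in> cliques S I" by (auto simp: link_cliques_iff[OF A])
    have "A \<union> (A - E \<union> C) = A \<union> C" by auto
    moreover have "A - E \<union> C \<in> cliques S I" using C(2) by (auto simp: cliques_def)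
    ultimately show "(case x of (C, E) \<Rightarrow> (A - E) \<union> C) \<in> {c. c \<in> cliques S I \<and> A \<union> c \<in> cliques S I}"
      using x C by simp
    show "((case x of (C, E) \<Rightarrow> (A - E) \<union> C) - A, A - (case x of (C, E) \<Rightarrow> (A - E) \<union> C)) = x"
      using x C by auto
  qed
  also have "\<dots> = (- \<rho>) ^ card A * (\<Sum>C\<in>cliques (link A) I. (- \<rho>\<^sup>2) ^ card C * diff_sum ?g A C)"
    unfolding diff_sum_def sum.cartesian_product[symmetric] by (simp add: sum_distrib_left)
  finally show ?thesis .
qed

end

section \<open>The system of cliques and its uniform measure\<close>

locale clique_system = independence S I
  for S :: "'a set" and I :: "('a \<times> 'a) set" +
  fixes act :: "'a set option \<Rightarrow> 'a list set \<Rightarrow> 'a set option"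
  assumes sys: "concurrent_system S I (cliques S I) act"
    and ext: "extends_clique_step S I act"
begin

lemma empty_clique: "{} \<in> cliques S I"
  by (simp add: cliques_def)

lemma act_Nil:
  assumes "c \<in> cliques S I"
  shows "act (Some c) (trace_of I []) = Some c"
proof -
  have "act s (trace_of I []) = s" if "s \<in> insert None (Some ` cliques S I)" for s
    using sys that unfolding concurrent_system_def trace_one by metis
  then show ?thesis using assms by simp
qed

lemma act_None: "w \<in> lists S \<Longrightarrow> act None (trace_of I w) = None"
  using sys unfolding concurrent_system_def trace_carrier by blast

lemma act_append:
  assumes "c \<in> cliques S I" "u \<in> lists S" "v \<in> lists S"
  shows "act (Some c) (trace_of I (u @ v)) = act (act (Some c) (trace_of I u)) (trace_of I v)"
proof -
  have "\<forall>s \<in> insert None (Some ` cliques S I). \<forall>x \<in> trace_of I ` lists S. \<forall>y \<in> trace_of I ` lists S.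
      act s (x \<otimes>\<^bsub>trace_monoid S I\<^esub> y) = act (act s x) y"
    using sys unfolding concurrent_system_def trace_carrier by blast
  then have "act (Some c) (trace_of I u \<otimes>\<^bsub>trace_monoid S I\<^esub> trace_of I v) =
      act (act (Some c) (trace_of I u)) (trace_of I v)"
    using assms by blast
  then show ?thesis by (simp only: trace_mult)
qed

lemma act_Cons:
  assumes "c \<in> cliques S I" "a \<in> S" "w \<in> lists S"
  shows "act (Some c) (trace_of I (a # w)) = act (clique_step S I c a) (trace_of I w)"
proof -
  have "act (Some c) (trace_of I [a]) = clique_step S I c a"
    using ext assms by (simp add: extends_clique_step_def)
  then show ?thesis using act_append[of c "[a]" w] assms by simp
qed

text \<open>Playing a clique toggles its letters, and this is possible exactly when it is compatible with
  the current state: letters that get removed are compatible with everything involved.\<close>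

lemma act_clique_word:
  assumes "distinct w" "set w \<in> cliques S I" "c \<in> cliques S I"
  shows "act (Some c) (trace_of I w) =
    (if c \<union> set w \<in> cliques S I then Some ((c - set w) \<union> (set w - c)) else None)"
  using assms
proof (induction w arbitrary: c)
  case Nil
  then show ?case by (simp add: act_Nil)
next
  case (Cons a w)
  have a: "a \<in> S" "a \<notin> set w" and w: "w \<in> lists S" "distinct w" "set w \<in> cliques S I"
    using Cons.prems by (auto simp: cliques_def)
  note step = act_Cons[OF Cons.prems(3) a(1) w(1)]
  consider "a \<in> c" | "a \<notin> c" "c \<union> {a} \<in> cliques S I" | "a \<notin> c" "c \<union> {a} \<notin> cliques S I" by blast
  then show ?case
  proof cases
    case 1
    have d: "c - {a} \<in> cliques S I" using Cons.prems(3) by (auto simp: cliques_def)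
    have iff: "(c - {a}) \<union> set w \<in> cliques S I \<longleftrightarrow> c \<union> set (a # w) \<in> cliques S I" (is "?L \<longleftrightarrow> ?R")
    proof
      assume ?L
      have "(x, y) \<in> I" if "x \<in> c \<union> set (a # w)" "y \<in> c \<union> set (a # w)" "x \<noteq> y" for x y
        using that \<open>?L\<close> Cons.prems(2,3) 1 by (cases "x = a"; cases "y = a") (auto simp: cliques_def)
      then show ?R using Cons.prems(2,3) by (auto simp: cliques_def)
    next
      assume ?R
      then show ?L by (auto simp: cliques_def)
    qed
    have eq: "(c - {a} - set w) \<union> (set w - (c - {a})) = (c - set (a # w)) \<union> (set (a # w) - c)"
      using 1 a by auto
    show ?thesis
      unfolding step using 1 Cons.IH[OF w(2,3) d] unfolding iff eq
      by (simp add: clique_step_def)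
  next
    case 2
    have iff: "(c \<union> {a}) \<union> set w = c \<union> set (a # w)" by auto
    have eq: "(c \<union> {a} - set w) \<union> (set w - (c \<union> {a})) = (c - set (a # w)) \<union> (set (a # w) - c)"
      using 2 a by auto
    show ?thesis
      unfolding step using 2 Cons.IH[OF w(2,3) 2(2)] unfolding iff eq
      by (simp add: clique_step_def)
  next
    case 3
    have "c \<union> set (a # w) \<notin> cliques S I"
      using 3(2) by (auto simp: cliques_def)
    then show ?thesis
      unfolding step using 3 act_None[OF w(1)] by (simp add: clique_step_def)
  qed
qed

lemma act_squares:
  assumes "set w \<subseteq> S"
  shows "act (Some {}) (trace_of I (power_word 2 w)) = Some {}"
  using assms
proof (induction w)
  case Nil
  then show ?case by (simp add: act_Nil empty_clique)
next
  case (Cons a w)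
  have a: "a \<in> S" and w: "power_word 2 w \<in> lists S"
    using Cons.prems by (simp_all add: power_word_in_lists del: in_lists_conv_set)
  have single: "{a} \<in> cliques S I" using a by (simp add: cliques_def)
  have "act (Some {}) (trace_of I (power_word 2 (a # w))) =
      act (Some {}) (trace_of I (a # a # power_word 2 w))"
    by (simp add: numeral_2_eq_2)
  also have "\<dots> = act (Some {a}) (trace_of I (a # power_word 2 w))"
    using act_Cons[OF empty_clique a, of "a # power_word 2 w"] w a single
    by (simp add: clique_step_def)
  also have "\<dots> = act (Some {}) (trace_of I (power_word 2 w))"
    using act_Cons[OF single a w] by (simp add: clique_step_def)
  finally show ?case using Cons by simp
qed

end

locale uniform_clique_system = clique_system S I act
  for S :: "'a set" and I :: "('a \<times> 'a) set" and act +
  fixes \<rho> :: real and \<Delta> :: "'a set \<Rightarrow> 'a set \<Rightarrow> real"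
    and m :: "'a set \<Rightarrow> (nat \<Rightarrow> 'a set) measure"
  assumes rho_pos: "0 < \<rho>"
    and cocycle: "positive_cocycle (cliques S I) \<Delta>"
    and markov: "markov_measure S I (cliques S I) act m"
    and m_upset: "\<And>\<alpha> x. \<alpha> \<in> cliques S I \<Longrightarrow> x \<in> carrier (trace_monoid S I) \<Longrightarrow>
      cocycle_valuation act \<rho> \<Delta> \<alpha> x = measure (m \<alpha>) (upset S I x)"
begin

lemma m_prob: "\<alpha> \<in> cliques S I \<Longrightarrow> prob_space (m \<alpha>)"
  and m_sets: "\<alpha> \<in> cliques S I \<Longrightarrow> sets (m \<alpha>) = sets (infinite_trace_borel S I)"
  using markov by (simp_all add: markov_measure_def)

lemma measure_upset:
  assumes "\<alpha> \<in> cliques S I" "w \<in> lists S"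
  shows "measure (m \<alpha>) (upset S I (trace_of I w)) =
    (case act (Some \<alpha>) (trace_of I w) of None \<Rightarrow> 0 | Some \<beta> \<Rightarrow> \<rho> ^ length w * \<Delta> \<alpha> \<beta>)"
  using m_upset[OF assms(1), of "trace_of I w"] assms(2)
  by (simp add: trace_carrier cocycle_valuation_def trace_length_trace_of
      del: in_lists_conv_set split: option.splits)

lemma cocycle_pos: "\<alpha> \<in> cliques S I \<Longrightarrow> \<beta> \<in> cliques S I \<Longrightarrow> 0 < \<Delta> \<alpha> \<beta>"
  and cocycle_mult: "\<alpha> \<in> cliques S I \<Longrightarrow> \<beta> \<in> cliques S I \<Longrightarrow> \<gamma> \<in> cliques S I \<Longrightarrow>
    \<Delta> \<alpha> \<gamma> = \<Delta> \<alpha> \<beta> * \<Delta> \<beta> \<gamma>"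
  using cocycle unfolding positive_cocycle_def by blast+

lemma cocycle_empty: "\<Delta> {} {} = 1"
  using cocycle_mult[OF empty_clique empty_clique empty_clique]
    cocycle_pos[OF empty_clique empty_clique] mult_cancel_left1 by (metis less_irrefl)

lemma enum_clique:
  assumes "c \<in> cliques S I"
  shows "distinct (enum c)" "set (enum c) = c" "set (enum c) \<subseteq> S" "enum c \<in> lists S"
    "length (enum c) = card c"
  using assms enum[of c] length_enum[of c] by (auto simp: cliques_def)

text \<open>From the empty state the clique word \<open>aabb\<dots>\<close> leads back to the empty state, so its probability is
  \<open>\<rho>\<^sup>2\<close> to the size of the clique. A Moebius value at \<open>\<rho>\<^sup>2\<close> is thereby the probability that no
  square \<open>aa\<close> with \<open>a \<in> T\<close> divides the infinite trace.\<close>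

lemma moebius_nonneg:
  assumes "T \<subseteq> S"
  shows "0 \<le> moebius T (\<rho>\<^sup>2)"
proof -
  interpret M: prob_space "m {}" by (rule m_prob[OF empty_clique])
  have "moebius T (\<rho>\<^sup>2) = (\<Sum>c\<in>cliques T I. (-1) ^ card c *
      measure (m {}) (upset S I (trace_of I (power_word 2 (enum c)))))"
    unfolding moebius_def
  proof (rule sum.cong[OF HOL.refl])
    fix c assume "c \<in> cliques T I"
    then have c: "c \<in> cliques S I" using assms by (auto simp: cliques_def)
    have "measure (m {}) (upset S I (trace_of I (power_word 2 (enum c)))) = \<rho> ^ (2 * card c)"
      using measure_upset[OF empty_clique power_word_in_lists] act_squares enum_clique[OF c]
      by (simp add: cocycle_empty)
    then show "(- \<rho>\<^sup>2) ^ card c =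
        (-1) ^ card c * measure (m {}) (upset S I (trace_of I (power_word 2 (enum c))))"
      by (simp add: power_mult power_minus[of "\<rho>\<^sup>2"])
  qed
  also have "\<dots> = 1 - measure (m {}) (\<Union>a\<in>T. upset S I (trace_of I (replicate 2 a)))"
    by (rule inclusion_exclusion_powers[symmetric, OF m_prob m_sets])
      (simp_all add: empty_clique assms)
  also have "\<dots> \<ge> 0" by simp
  finally show ?thesis .
qed

text \<open>Every infinite trace starts with some letter, so for single letters the same
  inclusion-exclusion sum vanishes, from every state.\<close>

lemma balance:
  assumes A: "A \<in> cliques S I"
  shows "(\<Sum>c | c \<in> cliques S I \<and> A \<union> c \<in> cliques S I.
    (- \<rho>) ^ card c * \<Delta> {} ((A - c) \<union> (c - A))) = 0"
proof -
  interpret M: prob_space "m A" by (rule m_prob[OF A])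
  have space: "space (m A) = infinite_traces S I"
    using sets_eq_imp_space_eq[OF m_sets[OF A]] space_borel by simp
  have "0 = 1 - measure (m A) (\<Union>a\<in>S. upset S I (trace_of I (replicate 1 a)))"
    using M.prob_space space upset_letters_cover by simp
  also have "\<dots> = (\<Sum>c\<in>cliques S I. (-1) ^ card c *
      measure (m A) (upset S I (trace_of I (power_word 1 (enum c)))))"
    by (rule inclusion_exclusion_powers[OF m_prob[OF A] m_sets[OF A]]) simp_all
  also have "\<dots> = (\<Sum>c\<in>cliques S I. if A \<union> c \<in> cliques S I
      then (- \<rho>) ^ card c * \<Delta> A ((A - c) \<union> (c - A)) else 0)"
  proof (rule sum.cong[OF HOL.refl])
    fix c assume c: "c \<in> cliques S I"
    have "measure (m A) (upset S I (trace_of I (enum c))) = (if A \<union> c \<in> cliques S I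
        then \<rho> ^ card c * \<Delta> A ((A - c) \<union> (c - A)) else 0)"
      using measure_upset[OF A, of "enum c"] act_clique_word[OF _ _ A, of "enum c"]
        enum_clique[OF c] c by simp
    then show "(-1) ^ card c * measure (m A) (upset S I (trace_of I (power_word 1 (enum c)))) =
        (if A \<union> c \<in> cliques S I then (- \<rho>) ^ card c * \<Delta> A ((A - c) \<union> (c - A)) else 0)"
      unfolding power_word_1 by (simp add: power_minus[of \<rho>])
  qed
  also have "\<dots> = (\<Sum>c | c \<in> cliques S I \<and> A \<union> c \<in> cliques S I.
      (- \<rho>) ^ card c * \<Delta> A ((A - c) \<union> (c - A)))"
    using finite_cliques[of S] by (simp add: sum.inter_filter)
  finally have "0 = \<Delta> {} A * (\<Sum>c | c \<in> cliques S I \<and> A \<union> c \<in> cliques S I.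
      (- \<rho>) ^ card c * \<Delta> A ((A - c) \<union> (c - A)))"
    by simp
  also have "\<dots> = (\<Sum>c | c \<in> cliques S I \<and> A \<union> c \<in> cliques S I.
      (- \<rho>) ^ card c * \<Delta> {} ((A - c) \<union> (c - A)))"
    unfolding sum_distrib_left
  proof (rule sum.cong[OF HOL.refl])
    fix c assume "c \<in> {c. c \<in> cliques S I \<and> A \<union> c \<in> cliques S I}"
    then have d: "(A - c) \<union> (c - A) \<in> cliques S I" by (auto simp: cliques_def)
    then show "\<Delta> {} A * ((- \<rho>) ^ card c * \<Delta> A ((A - c) \<union> (c - A))) =
        (- \<rho>) ^ card c * \<Delta> {} ((A - c) \<union> (c - A))"
      using cocycle_mult[OF empty_clique A d] by simp
  qed
  finally show ?thesis by simp
qed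

lemma diff_sum_balance:
  assumes "A \<in> cliques S I"
  shows "(\<Sum>C\<in>cliques (link A) I. (- \<rho>\<^sup>2) ^ card C *
    diff_sum (\<lambda>c. \<Delta> {} c / \<rho> ^ card c) A C) = 0"
  using balance[OF assms] sum_compatible_cliques[OF assms, of \<rho> "\<Delta> {}"] rho_pos by simp

lemma uniform_parameters:
  assumes conn: "irreducible_trace_monoid S I"
    and root: "smallest_modulus_root (mobius_poly S I) (complex_of_real r)"
  shows "r = \<rho>\<^sup>2" "\<And>c. c \<in> cliques S I \<Longrightarrow> \<Delta> {} c = \<rho> ^ card c"
proof -
  let ?g = "\<lambda>c. \<Delta> {} c / \<rho> ^ card c"
  have t: "0 < \<rho>\<^sup>2" using rho_pos by simp
  have link_ne: "moebius (link A) (\<rho>\<^sup>2) \<noteq> 0" if "A \<in> cliques S I" "A \<noteq> {}" for A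
  proof -
    have "link A \<subset> S" using that by (force simp: cliques_def link_def)
    then have "0 < moebius (link A) (\<rho>\<^sup>2)"
      by (intro moebius_pos_proper[OF conn _ t]) (simp_all add: moebius_nonneg)
    then show ?thesis by simp
  qed
  have const: "?g c = 1" if "c \<in> cliques S I" for c
  proof -
    have "?g c = ?g {}"
      by (rule constant_on_cliques[of "\<rho>\<^sup>2"]) (simp_all add: link_ne diff_sum_balance that)
    also have "\<dots> = 1" by (simp add: cocycle_empty)
    finally show ?thesis .
  qed
  then show D: "\<Delta> {} c = \<rho> ^ card c" if "c \<in> cliques S I" for c
    using that rho_pos by (simp add: field_simps)
  have "(\<Sum>C\<in>cliques S I. (- \<rho>\<^sup>2) ^ card C * diff_sum ?g {} C) = 0"
    using diff_sum_balance[OF empty_clique] by simp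
  then have "moebius S (\<rho>\<^sup>2) = 0"
    using const by (simp add: moebius_def diff_sum_def)
  then show "r = \<rho>\<^sup>2"
    by (intro smallest_modulus_root_eq[OF _ t _ root]) (simp_all add: moebius_nonneg)
qed

end

theorem mainTheorem10:
  fixes S :: "'a set" and I :: "('a \<times> 'a) set"
    and act :: "'a set option \<Rightarrow> 'a list set \<Rightarrow> 'a set option"
    and \<rho> r :: real and \<Delta> :: "'a set \<Rightarrow> 'a set \<Rightarrow> real"
  assumes "finite S" and "S \<noteq> {}"
    and "I \<subseteq> S \<times> S" and "irrefl I" and "sym I"
    and "irreducible_trace_monoid S I"
    and "irreducible_concurrent_system S I (cliques S I) act"
    and "extends_clique_step S I act"
    and "uniform_measure_parameters S I (cliques S I) act \<rho> \<Delta>"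
    and "smallest_modulus_root (mobius_poly S I) (complex_of_real r)"
  shows "\<rho> = sqrt r \<and>
    (\<forall>\<alpha> \<in> cliques S I. \<forall>\<beta> \<in> cliques S I.
       \<Delta> \<alpha> \<beta> = r powr ((real (card \<beta>) - real (card \<alpha>)) / 2))"
proof -
  obtain m where m: "markov_measure S I (cliques S I) act m"
    "\<forall>\<alpha>\<in>cliques S I. \<forall>x\<in>carrier (trace_monoid S I).
       cocycle_valuation act \<rho> \<Delta> \<alpha> x = measure (m \<alpha>) (upset S I x)"
    and pos: "0 < \<rho>" "positive_cocycle (cliques S I) \<Delta>"
    using assms(9) by (auto simp: uniform_measure_parameters_def probabilistic_valuation_def)
  interpret uniform_clique_system S I act \<rho> \<Delta> m
    using assms(1,3-8) m pos
    by unfold_locales (auto simp: irreducible_concurrent_system_def)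
  note r = uniform_parameters(1)[OF assms(6,10)] and D = uniform_parameters(2)[OF assms(6,10)]
  have "\<Delta> \<alpha> \<beta> = r powr ((real (card \<beta>) - real (card \<alpha>)) / 2)"
    if \<alpha>: "\<alpha> \<in> cliques S I" and \<beta>: "\<beta> \<in> cliques S I" for \<alpha> \<beta>
  proof -
    have "\<rho> ^ card \<beta> = \<rho> ^ card \<alpha> * \<Delta> \<alpha> \<beta>"
      using cocycle_mult[OF empty_clique \<alpha> \<beta>] D \<alpha> \<beta> by simp
    then have "\<Delta> \<alpha> \<beta> = \<rho> powr real (card \<beta>) / \<rho> powr real (card \<alpha>)"
      using pos(1) by (simp add: powr_realpow field_simps)
    also have "\<dots> = \<rho> powr (real (card \<beta>) - real (card \<alpha>))"
      by (rule powr_diff[symmetric])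
    also have "\<dots> = \<rho> powr (2 * ((real (card \<beta>) - real (card \<alpha>)) / 2))"
      by (rule arg_cong[of _ _ "(powr) \<rho>"]) simp
    also have "\<dots> = (\<rho> powr 2) powr ((real (card \<beta>) - real (card \<alpha>)) / 2)"
      by (simp only: powr_powr)
    also have "\<rho> powr 2 = r"
      using pos(1) r by simp
    finally show ?thesis .
  qed
  then show ?thesis using r pos(1) by simp
qed

end
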